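(* For every $n\geq 3$, there exists a finitely presented group $G$ for which the sequences $$H^n_b(G,\mathbb{R}) \xrightarrow{\ c^n\ } H^n(G,\mathbb{R}) \xrightarrow{\ \iota^n\ } H^n_{(\infty)}(G,\mathbb{R})$$ and $$H^n_b(G,\mathbb{Z}) \xrightarrow{\ c^n\ } H^n(G,\mathbb{Z}) \xrightarrow{\ \iota^n\ } H^n_{(\infty)}(G,\mathbb{Z})$$ are both not exact.
   Context: Let $A=\mathbb{Z}$ or $\mathbb{R}$ (trivial coefficients). $C^*(G,A)$ is the inhomogeneous bar complex of $G$; the bounded cochains (maps $G^n\to A$ with bounded image) form a subcomplex $C^*_b(G,A)$ with cohomology $H^*_b(G,A)$, and the inclusion induces the comparison map $c^*\colon H^*_b(G,A)\to H^*(G,A)$. $\ell^\infty(G,A)$ is the module of bounded functions $G\to A$, with the left $G$-action $(g\cdot f)(h)=f(g^{-1}h)$. $H^*_{(\infty)}(G,A)$ is the cohomology of the bar complex $C^*(G,\ell^\infty(G,A))$ with twisted coefficients. The inclusion of $A$ into $\ell^\infty(G,A)$ as constant functions induces $\iota^*\colon H^*(G,A)\to H^*_{(\infty)}(G,A)$. *)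

theory Defs
  imports Complex_Main "HOL-Algebra.Elementary_Groups" "HOL-Library.Function_Algebras"
begin

section \<open>Finitely presented groups\<close>

text \<open>Words are lists of signed letters; \<open>(s, True)\<close> stands for \<open>s\<close> and \<open>(s, False)\<close> for its
  formal inverse.\<close>

inductive cancels :: "('s \<times> bool) list \<Rightarrow> ('s \<times> bool) list \<Rightarrow> bool" where
  "cancels (u @ (s, b) # (s, \<not> b) # v) (u @ v)"

definition words :: "'s set \<Rightarrow> ('s \<times> bool) list set" where
  "words S = lists (S \<times> UNIV)"

definition free_rel :: "'s set \<Rightarrow> (('s \<times> bool) list \<times> ('s \<times> bool) list) set" where
  "free_rel S = {(u, v). u \<in> words S \<and> v \<in> words S \<and> equivclp cancels u v}"

definition free_group :: "'s set \<Rightarrow> ('s \<times> bool) list set monoid" where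
  "free_group S = \<lparr>carrier = words S // free_rel S,
     monoid.mult = (\<lambda>X Y. \<Union>x\<in>X. \<Union>y\<in>Y. free_rel S `` {x @ y}),
     one = free_rel S `` {[]}\<rparr>"

definition normal_closure :: "('a, 'b) monoid_scheme \<Rightarrow> 'a set \<Rightarrow> 'a set" where
  "normal_closure G R = \<Inter>{N. N \<lhd> G \<and> R \<subseteq> N}"

text \<open>Generators may be taken in \<^typ>\<open>nat\<close> because \<open>S\<close> is finite. For the same reason a finitely
  presented group is countable, so up to isomorphism its carrier is a set of natural numbers.\<close>

definition finitely_presented :: "('a, 'b) monoid_scheme \<Rightarrow> bool" where
  "finitely_presented G \<longleftrightarrow> group G \<and>
     (\<exists>(S :: nat set) R. finite S \<and> finite R \<and> R \<subseteq> carrier (free_group S) \<and>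
        G \<cong> free_group S Mod normal_closure (free_group S) R)"

lemma equivclp_cancels_append:
  assumes "equivclp cancels u u'"
  shows "equivclp cancels (p @ u @ q) (p @ u' @ q)"
  using assms
proof (induction rule: equivclp_induct)
  case base
  show ?case by simp
next
  case (step y z)
  have *: "cancels (p @ a @ q) (p @ b @ q)" if "cancels a b" for a b
    using that
  proof cases
    case (1 u s c v)
    then show ?thesis
      using cancels.intros[of "p @ u" s c "v @ q"] by simp
  qed
  from step.hyps(2) * have "equivclp cancels (p @ y @ q) (p @ z @ q)"
    by (meson converse_r_into_equivclp r_into_equivclp)
  with step.IH show ?case by (rule equivclp_trans)
qed

lemma equivclp_cancels_mult:
  assumes "equivclp cancels u u'" "equivclp cancels v v'"
  shows "equivclp cancels (u @ v) (u' @ v')"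
  using equivclp_cancels_append[OF assms(1), of "[]" v]
    equivclp_cancels_append[OF assms(2), of u' "[]"] by (auto intro: equivclp_trans)

lemma equiv_free_rel: "equiv (words S) (free_rel S)"
  by (rule equivI) (auto simp: free_rel_def refl_on_def sym_def trans_def
      intro: equivclp_sym equivclp_trans)

lemma words_append: "u \<in> words S \<Longrightarrow> v \<in> words S \<Longrightarrow> u @ v \<in> words S"
  by (auto simp: words_def)

lemma words_Nil: "[] \<in> words S"
  by (auto simp: words_def)

lemma free_group_mult:
  assumes "u \<in> words S" "v \<in> words S"
  shows "(free_rel S `` {u}) \<otimes>\<^bsub>free_group S\<^esub> (free_rel S `` {v}) = free_rel S `` {u @ v}"
proof -
  have "(\<Union>x\<in>free_rel S `` {u}. \<Union>y\<in>free_rel S `` {v}. free_rel S `` {x @ y}) = free_rel S `` {u @ v}"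
  proof (rule UN_equiv_class2[OF equiv_free_rel equiv_free_rel _ assms])
    show "congruent2 (free_rel S) (free_rel S) (\<lambda>x y. free_rel S `` {x @ y})"
    proof (rule congruent2I')
      fix a b c d assume "(a, b) \<in> free_rel S" "(c, d) \<in> free_rel S"
      then have "(a @ c, b @ d) \<in> free_rel S"
        by (auto simp: free_rel_def words_append equivclp_cancels_mult)
      then show "free_rel S `` {a @ c} = free_rel S `` {b @ d}"
        by (rule equiv_class_eq[OF equiv_free_rel])
    qed
  qed
  then show ?thesis by (simp add: free_group_def)
qed

definition word_inv :: "('s \<times> bool) list \<Rightarrow> ('s \<times> bool) list" where
  "word_inv u = rev (map (\<lambda>(s, b). (s, \<not> b)) u)"

lemma word_inv_cancels: "equivclp cancels (word_inv u @ u) []"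
proof (induction u)
  case Nil
  show ?case by (simp add: word_inv_def)
next
  case (Cons a u)
  obtain s b where a: "a = (s, b)" by (cases a)
  have "cancels (word_inv u @ (s, \<not> b) # (s, \<not> \<not> b) # u) (word_inv u @ u)"
    by (rule cancels.intros)
  then have "equivclp cancels (word_inv (a # u) @ a # u) (word_inv u @ u)"
    by (auto simp: a word_inv_def)
  with Cons.IH show ?case by (blast intro: equivclp_trans)
qed

lemma group_free_group: "group (free_group S)"
proof (rule groupI)
  have car: "carrier (free_group S) = (\<lambda>u. free_rel S `` {u}) ` words S"
    by (auto simp: free_group_def quotient_def)
  have one: "\<one>\<^bsub>free_group S\<^esub> = free_rel S `` {[]}"
    by (simp add: free_group_def)
  show "\<one>\<^bsub>free_group S\<^esub> \<in> carrier (free_group S)"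
    unfolding car one using words_Nil by blast
  show "x \<otimes>\<^bsub>free_group S\<^esub> y \<in> carrier (free_group S)"
    if "x \<in> carrier (free_group S)" "y \<in> carrier (free_group S)" for x y
    using that unfolding car by (auto simp: free_group_mult words_append)
  show "x \<otimes>\<^bsub>free_group S\<^esub> y \<otimes>\<^bsub>free_group S\<^esub> z
      = x \<otimes>\<^bsub>free_group S\<^esub> (y \<otimes>\<^bsub>free_group S\<^esub> z)"
    if "x \<in> carrier (free_group S)" "y \<in> carrier (free_group S)" "z \<in> carrier (free_group S)"
    for x y z
    using that unfolding car by (auto simp: free_group_mult words_append)
  show "\<one>\<^bsub>free_group S\<^esub> \<otimes>\<^bsub>free_group S\<^esub> x = x" if "x \<in> carrier (free_group S)" for x
    using that unfolding car one by (auto simp: free_group_mult words_Nil)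
  show "\<exists>y\<in>carrier (free_group S). y \<otimes>\<^bsub>free_group S\<^esub> x = \<one>\<^bsub>free_group S\<^esub>"
    if x: "x \<in> carrier (free_group S)" for x
  proof -
    obtain u where u: "u \<in> words S" "x = free_rel S `` {u}" using x unfolding car by blast
    have w: "word_inv u \<in> words S" using u(1) by (auto simp: words_def word_inv_def)
    have "(word_inv u @ u, []) \<in> free_rel S"
      using u w by (auto simp: free_rel_def words_append words_Nil word_inv_cancels)
    then have "free_rel S `` {word_inv u @ u} = free_rel S `` {[]}"
      by (rule equiv_class_eq[OF equiv_free_rel])
    then show ?thesis unfolding car one using u w by (auto simp: free_group_mult)
  qed
qed

lemma normal_closure_normal:
  assumes "group G" "R \<subseteq> carrier G"
  shows "normal_closure G R \<lhd> G"
proof -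
  interpret group G by fact
  have "carrier G \<lhd> G" by (rule normal_invI) (auto simp: subgroup_self)
  then have ne: "{N. N \<lhd> G \<and> R \<subseteq> N} \<noteq> {}" using assms(2) by blast
  show ?thesis unfolding normal_closure_def
  proof (rule normal_invI)
    show "subgroup (\<Inter>{N. N \<lhd> G \<and> R \<subseteq> N}) G"
      by (rule subgroups_Inter) (use ne normal_imp_subgroup in auto)
  qed (auto intro: normal.inv_op_closed2)
qed

section \<open>Cohomology of cochain complexes\<close>

text \<open>A cochain complex is given by subgroups \<open>C n\<close> of one ambient additive group and maps
  \<open>d n\<close> from \<open>C n\<close> to \<open>C (Suc n)\<close>.\<close>

definition cocycle_group ::
    "(nat \<Rightarrow> 'c::ab_group_add set) \<Rightarrow> (nat \<Rightarrow> 'c \<Rightarrow> 'c) \<Rightarrow> nat \<Rightarrow> 'c monoid" where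
  "cocycle_group C d n = \<lparr>carrier = {f \<in> C n. d n f = 0}, monoid.mult = (+), one = 0\<rparr>"

definition coboundaries ::
    "(nat \<Rightarrow> 'c::ab_group_add set) \<Rightarrow> (nat \<Rightarrow> 'c \<Rightarrow> 'c) \<Rightarrow> nat \<Rightarrow> 'c set" where
  "coboundaries C d n = (case n of 0 \<Rightarrow> {0} | Suc m \<Rightarrow> d m ` C m)"

definition cohomology ::
    "(nat \<Rightarrow> 'c::ab_group_add set) \<Rightarrow> (nat \<Rightarrow> 'c \<Rightarrow> 'c) \<Rightarrow> nat \<Rightarrow> 'c set monoid" where
  "cohomology C d n = cocycle_group C d n Mod coboundaries C d n"

text \<open>The map induced by a cochain map \<open>\<phi>\<close> into the complex \<open>(C', d')\<close>: all members of
  a class give the same coset, so the union below is that coset.\<close>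

definition cohomology_map ::
    "(nat \<Rightarrow> 'c'::ab_group_add set) \<Rightarrow> (nat \<Rightarrow> 'c' \<Rightarrow> 'c') \<Rightarrow> ('c \<Rightarrow> 'c') \<Rightarrow> nat
      \<Rightarrow> 'c set \<Rightarrow> 'c' set" where
  "cohomology_map C' d' \<phi> n X = (\<Union>f\<in>X. coboundaries C' d' n #>\<^bsub>cocycle_group C' d' n\<^esub> \<phi> f)"

definition exact_at ::
    "('a, 'k) monoid_scheme \<Rightarrow> ('a \<Rightarrow> 'b) \<Rightarrow> ('b, 'l) monoid_scheme \<Rightarrow> ('b \<Rightarrow> 'c)
      \<Rightarrow> ('c, 'm) monoid_scheme \<Rightarrow> bool" where
  "exact_at H f K g L \<longleftrightarrow> f ` carrier H = kernel K L g"

locale cochain_complex =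
  fixes C :: "nat \<Rightarrow> 'c::ab_group_add set" and d :: "nat \<Rightarrow> 'c \<Rightarrow> 'c"
  assumes zero_mem: "0 \<in> C n"
    and diff_mem: "f \<in> C n \<Longrightarrow> g \<in> C n \<Longrightarrow> f - g \<in> C n"
    and d_mem: "f \<in> C n \<Longrightarrow> d n f \<in> C (Suc n)"
    and d_diff: "f \<in> C n \<Longrightarrow> g \<in> C n \<Longrightarrow> d n (f - g) = d n f - d n g"
    and d_d: "f \<in> C n \<Longrightarrow> d (Suc n) (d n f) = 0"
begin

lemma minus_mem: "f \<in> C n \<Longrightarrow> - f \<in> C n"
  using diff_mem[OF zero_mem, of f n] by simp

lemma add_mem: "f \<in> C n \<Longrightarrow> g \<in> C n \<Longrightarrow> f + g \<in> C n"
  using diff_mem[of f n "- g"] minus_mem by simp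

lemma d_zero: "d n 0 = 0"
  using d_diff[OF zero_mem zero_mem] by simp

lemma d_minus: "f \<in> C n \<Longrightarrow> d n (- f) = - d n f"
  using d_diff[OF zero_mem, of f n] by (simp add: d_zero)

lemma d_add: "f \<in> C n \<Longrightarrow> g \<in> C n \<Longrightarrow> d n (f + g) = d n f + d n g"
  using d_diff[of f n "- g"] minus_mem[of g] d_minus[of g] by simp

lemma comm_group_cocycles: "comm_group (cocycle_group C d n)"
proof (rule comm_groupI)
  show "\<exists>y\<in>carrier (cocycle_group C d n). y \<otimes>\<^bsub>cocycle_group C d n\<^esub> x = \<one>\<^bsub>cocycle_group C d n\<^esub>"
    if "x \<in> carrier (cocycle_group C d n)" for x
    using that by (intro bexI[of _ "- x"]) (auto simp: cocycle_group_def minus_mem d_minus)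
qed (auto simp: cocycle_group_def add_mem d_add zero_mem d_zero add_ac)

lemma inv_cocycle:
  assumes "f \<in> carrier (cocycle_group C d n)"
  shows "inv\<^bsub>cocycle_group C d n\<^esub> f = - f"
proof -
  interpret comm_group "cocycle_group C d n" by (rule comm_group_cocycles)
  show ?thesis
    by (rule inv_equality) (use assms in \<open>auto simp: cocycle_group_def minus_mem d_minus\<close>)
qed

lemma coboundaries_normal: "coboundaries C d n \<lhd> cocycle_group C d n"
proof -
  interpret Z: comm_group "cocycle_group C d n" by (rule comm_group_cocycles)
  have sub: "coboundaries C d n \<subseteq> carrier (cocycle_group C d n)"
    by (cases n) (auto simp: coboundaries_def cocycle_group_def zero_mem d_zero d_mem d_d)
  have "subgroup (coboundaries C d n) (cocycle_group C d n)"
  proof (rule Z.subgroupI[OF sub])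
    show "coboundaries C d n \<noteq> {}"
      using zero_mem by (cases n) (auto simp: coboundaries_def)
    show "inv\<^bsub>cocycle_group C d n\<^esub> a \<in> coboundaries C d n" if "a \<in> coboundaries C d n" for a
    proof -
      have "- a \<in> coboundaries C d n"
      proof (cases n)
        case 0
        with that show ?thesis by (simp add: coboundaries_def)
      next
        case (Suc m)
        with that obtain x where "x \<in> C m" "a = d m x" by (auto simp: coboundaries_def)
        with Suc show ?thesis
          using minus_mem[of x m] d_minus[of x m, symmetric] by (auto simp: coboundaries_def)
      qed
      then show ?thesis using inv_cocycle[of a n] that sub by auto
    qed
    show "a \<otimes>\<^bsub>cocycle_group C d n\<^esub> b \<in> coboundaries C d n"
      if "a \<in> coboundaries C d n" "b \<in> coboundaries C d n" for a b
      using that by (cases n) (auto simp: coboundaries_def cocycle_group_def image_iff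
          intro!: bexI[of _ "_ + _"] d_add[symmetric] add_mem)
  qed
  then show ?thesis by (rule Z.subgroup_imp_normal)
qed

lemma comm_group_cohomology: "comm_group (cohomology C d n)"
  unfolding cohomology_def
  using comm_group.abelian_FactGroup[OF comm_group_cocycles] coboundaries_normal normal_imp_subgroup
  by blast

end

lemma cohomology_map_coset:
  assumes "cochain_complex C d" "cochain_complex C' d'"
    and mem: "\<And>m f. f \<in> C m \<Longrightarrow> \<phi> f \<in> C' m"
    and add: "\<And>m f g. f \<in> C m \<Longrightarrow> g \<in> C m \<Longrightarrow> \<phi> (f + g) = \<phi> f + \<phi> g"
    and comm: "\<And>m f. f \<in> C m \<Longrightarrow> \<phi> (d m f) = d' m (\<phi> f)"
    and f: "f \<in> carrier (cocycle_group C d n)"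
  shows "cohomology_map C' d' \<phi> n (coboundaries C d n #>\<^bsub>cocycle_group C d n\<^esub> f)
    = coboundaries C' d' n #>\<^bsub>cocycle_group C' d' n\<^esub> \<phi> f"
    and "\<phi> f \<in> carrier (cocycle_group C' d' n)"
proof -
  interpret C: cochain_complex C d by fact
  interpret C': cochain_complex C' d' by fact
  interpret Z: comm_group "cocycle_group C d n" by (rule C.comm_group_cocycles)
  interpret Z': comm_group "cocycle_group C' d' n" by (rule C'.comm_group_cocycles)
  interpret N: normal "coboundaries C d n" "cocycle_group C d n" by (rule C.coboundaries_normal)
  interpret N': normal "coboundaries C' d' n" "cocycle_group C' d' n" by (rule C'.coboundaries_normal)
  have zero: "\<phi> 0 = 0" using add[OF C.zero_mem C.zero_mem] by simp
  have Z': "\<phi> g \<in> carrier (cocycle_group C' d' n)" if "g \<in> carrier (cocycle_group C d n)" for g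
    using that comm[of g n] by (auto simp: cocycle_group_def mem zero)
  show "\<phi> f \<in> carrier (cocycle_group C' d' n)" by (rule Z'[OF f])
  have B: "\<phi> b \<in> coboundaries C' d' n" if "b \<in> coboundaries C d n" for b
    using that by (cases n) (auto simp: coboundaries_def zero comm mem)
  have const: "coboundaries C' d' n #>\<^bsub>cocycle_group C' d' n\<^esub> \<phi> g
      = coboundaries C' d' n #>\<^bsub>cocycle_group C' d' n\<^esub> \<phi> f"
    if g: "g \<in> coboundaries C d n #>\<^bsub>cocycle_group C d n\<^esub> f" for g
  proof -
    obtain b where b: "b \<in> coboundaries C d n" "g = b + f"
      using g by (auto simp: r_coset_def cocycle_group_def)
    have bZ: "b \<in> carrier (cocycle_group C d n)" using b(1) N.subset by blast
    have "\<phi> g = \<phi> b + \<phi> f"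
      unfolding b(2) by (rule add[of _ n]) (use bZ f in \<open>auto simp: cocycle_group_def\<close>)
    then have "\<phi> g \<in> coboundaries C' d' n #>\<^bsub>cocycle_group C' d' n\<^esub> \<phi> f"
      using B[OF b(1)] by (auto simp: r_coset_def cocycle_group_def)
    then show ?thesis
      using Z'.repr_independence[OF _ Z'[OF f] N'.subgroup_axioms] by simp
  qed
  have "f \<in> coboundaries C d n #>\<^bsub>cocycle_group C d n\<^esub> f"
    by (rule Z.rcos_self[OF f N.subgroup_axioms])
  then show "cohomology_map C' d' \<phi> n (coboundaries C d n #>\<^bsub>cocycle_group C d n\<^esub> f)
    = coboundaries C' d' n #>\<^bsub>cocycle_group C' d' n\<^esub> \<phi> f"
    unfolding cohomology_map_def using const by blast
qed

lemma cohomology_map_hom: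
  assumes "cochain_complex C d" "cochain_complex C' d'"
    and "\<And>m f. f \<in> C m \<Longrightarrow> \<phi> f \<in> C' m"
    and add: "\<And>m f g. f \<in> C m \<Longrightarrow> g \<in> C m \<Longrightarrow> \<phi> (f + g) = \<phi> f + \<phi> g"
    and "\<And>m f. f \<in> C m \<Longrightarrow> \<phi> (d m f) = d' m (\<phi> f)"
  shows "cohomology_map C' d' \<phi> n \<in> hom (cohomology C d n) (cohomology C' d' n)"
proof -
  interpret N: normal "coboundaries C d n" "cocycle_group C d n"
    by (rule cochain_complex.coboundaries_normal) fact
  interpret N': normal "coboundaries C' d' n" "cocycle_group C' d' n"
    by (rule cochain_complex.coboundaries_normal) fact
  have eq: "cohomology_map C' d' \<phi> n (coboundaries C d n #>\<^bsub>cocycle_group C d n\<^esub> f)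
      = coboundaries C' d' n #>\<^bsub>cocycle_group C' d' n\<^esub> \<phi> f"
    and Z': "\<phi> f \<in> carrier (cocycle_group C' d' n)"
    if "f \<in> carrier (cocycle_group C d n)" for f
    by (rule cohomology_map_coset[where C = C and d = d and C' = C' and d' = d' and \<phi> = \<phi>]; fact)+
  have add': "\<phi> (f \<otimes>\<^bsub>cocycle_group C d n\<^esub> g) = \<phi> f \<otimes>\<^bsub>cocycle_group C' d' n\<^esub> \<phi> g"
    if "f \<in> carrier (cocycle_group C d n)" "g \<in> carrier (cocycle_group C d n)" for f g
    using that add[of f n g] by (auto simp: cocycle_group_def)
  show ?thesis
    unfolding cohomology_def
  proof (rule homI)
    fix X assume "X \<in> carrier (cocycle_group C d n Mod coboundaries C d n)"
    then obtain f where "f \<in> carrier (cocycle_group C d n)"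
      "X = coboundaries C d n #>\<^bsub>cocycle_group C d n\<^esub> f"
      by (auto simp: carrier_FactGroup)
    then show "cohomology_map C' d' \<phi> n X \<in> carrier (cocycle_group C' d' n Mod coboundaries C' d' n)"
      using eq[of f] Z'[of f] by (auto simp: carrier_FactGroup)
    fix Y assume "Y \<in> carrier (cocycle_group C d n Mod coboundaries C d n)"
    then obtain g where "g \<in> carrier (cocycle_group C d n)"
      "Y = coboundaries C d n #>\<^bsub>cocycle_group C d n\<^esub> g"
      by (auto simp: carrier_FactGroup)
    with \<open>f \<in> _\<close> \<open>X = _\<close> show "cohomology_map C' d' \<phi> n (X \<otimes>\<^bsub>cocycle_group C d n Mod coboundaries C d n\<^esub> Y)
      = cohomology_map C' d' \<phi> n X
        \<otimes>\<^bsub>cocycle_group C' d' n Mod coboundaries C' d' n\<^esub> cohomology_map C' d' \<phi> n Y"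
      using eq[of f] eq[of g] eq[of "f \<otimes>\<^bsub>cocycle_group C d n\<^esub> g"] Z'[of f] Z'[of g]
      by (simp add: N.rcos_sum N'.rcos_sum add')
  qed
qed

section \<open>The inhomogeneous bar complex\<close>

definition tuples :: "('g, 'k) monoid_scheme \<Rightarrow> nat \<Rightarrow> 'g list set" where
  "tuples G n = {xs. length xs = n \<and> set xs \<subseteq> carrier G}"

text \<open>Functions on a subset (here on tuples, and later on the carrier of \<open>G\<close>) are represented by
  total functions that vanish outside of it, so that they are added and subtracted pointwise.\<close>

definition cochains :: "('g, 'k) monoid_scheme \<Rightarrow> 'm::ab_group_add set \<Rightarrow> nat \<Rightarrow> ('g list \<Rightarrow> 'm) set" where
  "cochains G M n = {f. (\<forall>xs\<in>tuples G n. f xs \<in> M) \<and> (\<forall>xs. xs \<notin> tuples G n \<longrightarrow> f xs = 0)}"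

definition alt :: "nat \<Rightarrow> 'm::ab_group_add \<Rightarrow> 'm" where
  "alt i x = (if even i then x else - x)"

text \<open>On \<open>xs = [g\<^sub>1, \<dots>, g\<^sub>k]\<close>, for \<open>1 \<le> i < k\<close>: replace \<open>g\<^sub>i, g\<^sub>i\<^sub>+\<^sub>1\<close> by their product.\<close>

definition merge :: "('g, 'k) monoid_scheme \<Rightarrow> nat \<Rightarrow> 'g list \<Rightarrow> 'g list" where
  "merge G i xs = take (i - 1) xs @ (xs ! (i - 1) \<otimes>\<^bsub>G\<^esub> xs ! i) # drop (i + 1) xs"

definition coboundary :: "('g, 'k) monoid_scheme \<Rightarrow> ('g \<Rightarrow> 'm \<Rightarrow> 'm) \<Rightarrow> nat
    \<Rightarrow> ('g list \<Rightarrow> 'm::ab_group_add) \<Rightarrow> 'g list \<Rightarrow> 'm" where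
  "coboundary G act n f = (\<lambda>xs. if xs \<in> tuples G (Suc n)
     then act (hd xs) (f (tl xs)) + (\<Sum>i=1..n. alt i (f (merge G i xs))) + alt (Suc n) (f (butlast xs))
     else 0)"

section \<open>Ordinary, bounded and \<open>\<ell>\<^sup>\<infinity>\<close>-cohomology\<close>

text \<open>The coefficients \<open>\<int>\<close> and \<open>\<real>\<close> are the types \<^typ>\<open>int\<close> and \<^typ>\<open>real\<close>.\<close>

definition trivial_action :: "'g \<Rightarrow> 'a \<Rightarrow> 'a" where
  "trivial_action g a = a"

definition group_cohomology ::
    "('g, 'k) monoid_scheme \<Rightarrow> nat \<Rightarrow> ('g list \<Rightarrow> 'a::linordered_idom) set monoid" where
  "group_cohomology G = cohomology (cochains G UNIV) (coboundary G trivial_action)"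

definition bounded_cochains ::
    "('g, 'k) monoid_scheme \<Rightarrow> nat \<Rightarrow> ('g list \<Rightarrow> 'a::linordered_idom) set" where
  "bounded_cochains G n = {f \<in> cochains G UNIV n. \<exists>c. \<forall>xs\<in>tuples G n. \<bar>f xs\<bar> \<le> c}"

definition bounded_cohomology ::
    "('g, 'k) monoid_scheme \<Rightarrow> nat \<Rightarrow> ('g list \<Rightarrow> 'a::linordered_idom) set monoid" where
  "bounded_cohomology G = cohomology (bounded_cochains G) (coboundary G trivial_action)"

definition linf :: "('g, 'k) monoid_scheme \<Rightarrow> ('g \<Rightarrow> 'a::linordered_idom) set" where
  "linf G = {f. (\<exists>c. \<forall>h\<in>carrier G. \<bar>f h\<bar> \<le> c) \<and> (\<forall>h. h \<notin> carrier G \<longrightarrow> f h = 0)}"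

definition linf_action ::
    "('g, 'k) monoid_scheme \<Rightarrow> 'g \<Rightarrow> ('g \<Rightarrow> 'a::linordered_idom) \<Rightarrow> 'g \<Rightarrow> 'a" where
  "linf_action G g f = (\<lambda>h. if h \<in> carrier G then f (inv\<^bsub>G\<^esub> g \<otimes>\<^bsub>G\<^esub> h) else 0)"

definition linf_cohomology ::
    "('g, 'k) monoid_scheme \<Rightarrow> nat \<Rightarrow> ('g list \<Rightarrow> 'g \<Rightarrow> 'a::linordered_idom) set monoid" where
  "linf_cohomology G = cohomology (cochains G (linf G)) (coboundary G (linf_action G))"

definition comparison_map :: "('g, 'k) monoid_scheme \<Rightarrow> nat
    \<Rightarrow> ('g list \<Rightarrow> 'a::linordered_idom) set \<Rightarrow> ('g list \<Rightarrow> 'a) set" where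
  "comparison_map G = cohomology_map (cochains G UNIV) (coboundary G trivial_action) (\<lambda>f. f)"

definition const_fun :: "('g, 'k) monoid_scheme \<Rightarrow> 'a::linordered_idom \<Rightarrow> 'g \<Rightarrow> 'a" where
  "const_fun G a = (\<lambda>h. if h \<in> carrier G then a else 0)"

definition iota_map :: "('g, 'k) monoid_scheme \<Rightarrow> nat
    \<Rightarrow> ('g list \<Rightarrow> 'a::linordered_idom) set \<Rightarrow> ('g list \<Rightarrow> 'g \<Rightarrow> 'a) set" where
  "iota_map G = cohomology_map (cochains G (linf G)) (coboundary G (linf_action G))
     (\<lambda>f xs. const_fun G (f xs))"

subsection \<open>Well-definedness\<close>

locale group_module = group G for G (structure) +
  fixes M :: "'m::ab_group_add set" and act :: "'a \<Rightarrow> 'm \<Rightarrow> 'm"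
  assumes zero_mem: "0 \<in> M"
    and diff_mem: "x \<in> M \<Longrightarrow> y \<in> M \<Longrightarrow> x - y \<in> M"
    and act_mem: "g \<in> carrier G \<Longrightarrow> x \<in> M \<Longrightarrow> act g x \<in> M"
    and act_diff: "g \<in> carrier G \<Longrightarrow> x \<in> M \<Longrightarrow> y \<in> M \<Longrightarrow> act g (x - y) = act g x - act g y"
    and act_one: "x \<in> M \<Longrightarrow> act \<one> x = x"
    and act_mult: "g \<in> carrier G \<Longrightarrow> h \<in> carrier G \<Longrightarrow> x \<in> M \<Longrightarrow> act (g \<otimes> h) x = act g (act h x)"

definition bar_face :: "('g, 'k) monoid_scheme \<Rightarrow> nat \<Rightarrow> 'g list \<Rightarrow> 'g list" where
  "bar_face G i xs = (if i = 0 then tl xs else if i = length xs then butlast xs else merge G i xs)"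

definition bar_coeff :: "('g, 'k) monoid_scheme \<Rightarrow> nat \<Rightarrow> 'g list \<Rightarrow> 'g" where
  "bar_coeff G i xs = (if i = 0 then hd xs else \<one>\<^bsub>G\<^esub>)"

lemma length_bar_face: "i \<le> length xs \<Longrightarrow> xs \<noteq> [] \<Longrightarrow> length (bar_face G i xs) = length xs - 1"
  by (auto simp: bar_face_def merge_def min_def)

lemma nth_bar_face:
  assumes "i \<le> length xs" "Suc k < length xs"
  shows "bar_face G i xs ! k =
    (if Suc k < i then xs ! k else if Suc k = i then xs ! k \<otimes>\<^bsub>G\<^esub> xs ! Suc k else xs ! Suc k)"
proof (cases "i = 0 \<or> i = length xs")
  case True
  then show ?thesis using assms by (auto simp: bar_face_def nth_tl nth_butlast)
next
  case False
  then obtain j where i: "i = Suc j" "Suc j < length xs" using assms(1) by (cases i) auto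
  then have "bar_face G i xs = take j xs @ (xs ! j \<otimes>\<^bsub>G\<^esub> xs ! Suc j) # drop (Suc (Suc j)) xs"
    by (simp add: bar_face_def merge_def)
  moreover consider "k < j" | "k = j" | m where "k = Suc (j + m)"
    using less_iff_Suc_add[of j k] by fastforce
  ultimately show ?thesis
    using i assms by cases (simp_all add: nth_append)
qed

context group
begin

lemma tuples_iff: "xs \<in> tuples G n \<longleftrightarrow> length xs = n \<and> (\<forall>k<n. xs ! k \<in> carrier G)"
  by (auto simp: tuples_def set_conv_nth)

lemma bar_face_mem:
  assumes "xs \<in> tuples G (Suc n)" "i \<le> Suc n"
  shows "bar_face G i xs \<in> tuples G n"
proof -
  have "xs \<noteq> []" using assms by (auto simp: tuples_iff)
  then show ?thesis using assms by (auto simp: tuples_iff length_bar_face nth_bar_face)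
qed

lemma bar_coeff_mem: "xs \<in> tuples G (Suc n) \<Longrightarrow> bar_coeff G i xs \<in> carrier G"
  by (cases xs) (auto simp: tuples_def bar_coeff_def)

lemma bar_face_bar_face:
  assumes "xs \<in> tuples G (Suc (Suc n))" "i < j" "j \<le> Suc (Suc n)"
  shows "bar_face G i (bar_face G j xs) = bar_face G (j - 1) (bar_face G i xs)"
proof (rule nth_equalityI)
  have xs: "length xs = Suc (Suc n)" "\<And>k. k < Suc (Suc n) \<Longrightarrow> xs ! k \<in> carrier G"
    using assms by (auto simp: tuples_iff)
  have l: "length (bar_face G j xs) = Suc n" "length (bar_face G i xs) = Suc n"
    using assms bar_face_mem[OF assms(1), of i] bar_face_mem[OF assms(1), of j]
    by (auto simp: tuples_def)
  then have l': "length (bar_face G i (bar_face G j xs)) = n"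
      "length (bar_face G (j - 1) (bar_face G i xs)) = n"
    using length_bar_face[of i "bar_face G j xs" G] length_bar_face[of "j - 1" "bar_face G i xs" G] assms(2,3)
    by force+
  then show "length (bar_face G i (bar_face G j xs)) = length (bar_face G (j - 1) (bar_face G i xs))"
    by simp
  fix k assume "k < length (bar_face G i (bar_face G j xs))"
  then have k: "k < n" using l' by simp
  show "bar_face G i (bar_face G j xs) ! k = bar_face G (j - 1) (bar_face G i xs) ! k"
  proof -
    have j: "j - 1 \<le> Suc n" "i \<le> Suc n" "Suc k < Suc n" "i \<le> Suc (Suc n)"
      using assms(2,3) k by auto
    have L: "bar_face G j xs ! m = (if Suc m < j then xs ! m
        else if Suc m = j then xs ! m \<otimes> xs ! Suc m else xs ! Suc m)" if "m < Suc n" for m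
      using that assms(3) xs(1) by (intro nth_bar_face) auto
    have R: "bar_face G i xs ! m = (if Suc m < i then xs ! m
        else if Suc m = i then xs ! m \<otimes> xs ! Suc m else xs ! Suc m)" if "m < Suc n" for m
      using that j(4) xs(1) by (intro nth_bar_face) auto
    have kc: "xs ! k \<in> carrier G" "xs ! Suc k \<in> carrier G" "xs ! Suc (Suc k) \<in> carrier G"
      using k xs(2) by auto
    have k': "k < Suc n" "Suc k < Suc n" using k by auto
    obtain p where p: "j = Suc p" "i \<le> p" using assms(2) by (cases j) auto
    have 1: "bar_face G i (bar_face G j xs) ! k = (if Suc k < i then bar_face G j xs ! k
        else if Suc k = i then bar_face G j xs ! k \<otimes> bar_face G j xs ! Suc k
        else bar_face G j xs ! Suc k)"
      using j l by (intro nth_bar_face) auto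
    have 2: "bar_face G (j - 1) (bar_face G i xs) ! k = (if Suc k < p then bar_face G i xs ! k
        else if Suc k = p then bar_face G i xs ! k \<otimes> bar_face G i xs ! Suc k
        else bar_face G i xs ! Suc k)"
      using j l p by (simp add: nth_bar_face)
    consider "Suc k < i" | "Suc k = i" "p = i" | "Suc k = i" "i < p"
      | "i < Suc k" "Suc k < p" | "i < Suc k" "Suc k = p" | "p < Suc k"
      using p(2) by linarith
    then show ?thesis
      unfolding 1 2 L[OF k'(1)] L[OF k'(2)] R[OF k'(1)] R[OF k'(2)]
      by cases (use p kc in \<open>simp_all add: m_assoc\<close>)
  qed
qed

lemma bar_coeff_bar_coeff:
  assumes "xs \<in> tuples G (Suc (Suc n))" "i < j" "j \<le> Suc (Suc n)"
  shows "bar_coeff G j xs \<otimes> bar_coeff G i (bar_face G j xs)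
    = bar_coeff G i xs \<otimes> bar_coeff G (j - 1) (bar_face G i xs)"
proof -
  have xs: "length xs = Suc (Suc n)" "\<And>k. k < Suc (Suc n) \<Longrightarrow> xs ! k \<in> carrier G"
    using assms by (auto simp: tuples_iff)
  have hd: "hd (bar_face G m xs) = bar_face G m xs ! 0" if "m \<le> Suc (Suc n)" for m
    using that bar_face_mem[OF assms(1) that]
    by (intro hd_conv_nth) (auto simp: tuples_def)
  have "hd xs = xs ! 0" using xs by (intro hd_conv_nth) auto
  then show ?thesis
    using assms(2,3) xs xs(2)[of 0] xs(2)[of 1] by (auto simp: bar_coeff_def hd nth_bar_face)
qed

end

lemma alt_alt: "alt i (alt j x) = alt (i + j) x"
  by (auto simp: alt_def)

lemma alt_diff: "alt i (x - y) = alt i x - alt i y"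
  by (auto simp: alt_def)

lemma alt_sum: "alt i (sum f A) = (\<Sum>x\<in>A. alt i (f x))"
  by (auto simp: alt_def sum_negf)

lemma alternating_double_sum:
  assumes "\<And>i j. i < j \<Longrightarrow> j \<le> Suc m \<Longrightarrow> T j i = T i (j - 1)"
  shows "(\<Sum>j\<le>Suc m. \<Sum>i\<le>m. alt (j + i) (T j i)) = 0"
proof -
  let ?f = "\<lambda>(j, i). alt (j + i) (T j i)"
  let ?U = "{(j, i). j \<le> Suc m \<and> i < j}" and ?L = "{(j, i). j \<le> i \<and> i \<le> m}"
  have fin: "finite ?U" "finite ?L"
    by (rule finite_subset[of _ "{..Suc m} \<times> {..Suc m}"]; force)+
  have "sum ?f ?U = (\<Sum>p\<in>?L. - ?f p)"
  proof (rule sum.reindex_bij_witness[where i = "\<lambda>(i, k). (Suc k, i)" and j = "\<lambda>(j, i). (i, j - 1)"],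
      goal_cases)
    case (5 p)
    then obtain j i where p: "p = (j, i)" "j \<le> Suc m" "i < j" by auto
    then obtain k where "j = Suc k" by (cases j) auto
    with p assms[of i j] show ?case by (auto simp: alt_def)
  qed auto
  then have "sum ?f ?U + sum ?f ?L = 0"
    by (simp add: sum_negf split_def)
  moreover have "sum ?f (?U \<union> ?L) = sum ?f ?U + sum ?f ?L"
    by (rule sum.union_disjoint[OF fin]) auto
  moreover have "?U \<union> ?L = {..Suc m} \<times> {..m}" by auto
  ultimately show ?thesis by (simp add: sum.cartesian_product)
qed

context group_module
begin

lemma minus_mem: "x \<in> M \<Longrightarrow> - x \<in> M"
  using diff_mem[OF zero_mem, of x] by simp

lemma add_mem: "x \<in> M \<Longrightarrow> y \<in> M \<Longrightarrow> x + y \<in> M"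
  using diff_mem[of x "- y"] minus_mem by simp

lemma sum_mem: "(\<And>i. i \<in> I \<Longrightarrow> f i \<in> M) \<Longrightarrow> sum f I \<in> M"
  by (induction I rule: infinite_finite_induct) (auto simp: zero_mem add_mem)

lemma alt_mem: "x \<in> M \<Longrightarrow> alt i x \<in> M"
  by (auto simp: alt_def minus_mem)

lemma act_zero: "g \<in> carrier G \<Longrightarrow> act g 0 = 0"
  using act_diff[OF _ zero_mem zero_mem] by simp

lemma act_minus: "g \<in> carrier G \<Longrightarrow> x \<in> M \<Longrightarrow> act g (- x) = - act g x"
  using act_diff[OF _ zero_mem, of g x] by (simp add: act_zero)

lemma act_add: "g \<in> carrier G \<Longrightarrow> x \<in> M \<Longrightarrow> y \<in> M \<Longrightarrow> act g (x + y) = act g x + act g y"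
  using act_diff[of g x "- y"] by (simp add: minus_mem act_minus)

lemma act_sum: "g \<in> carrier G \<Longrightarrow> (\<And>i. i \<in> I \<Longrightarrow> f i \<in> M) \<Longrightarrow> act g (sum f I) = (\<Sum>i\<in>I. act g (f i))"
  by (induction I rule: infinite_finite_induct) (auto simp: act_zero act_add sum_mem)

lemma act_alt: "g \<in> carrier G \<Longrightarrow> x \<in> M \<Longrightarrow> act g (alt i x) = alt i (act g x)"
  by (auto simp: alt_def act_minus)

lemma coboundary_eq:
  assumes f: "f \<in> cochains G M n" and xs: "xs \<in> tuples G (Suc n)"
  shows "coboundary G act n f xs
    = (\<Sum>i\<le>Suc n. alt i (act (bar_coeff G i xs) (f (bar_face G i xs))))"
proof -
  have l: "length xs = Suc n" using xs by (simp add: tuples_def)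
  have mem: "f (bar_face G i xs) \<in> M" if "i \<le> Suc n" for i
    using f bar_face_mem[OF xs that] by (auto simp: cochains_def)
  have "(\<Sum>i\<le>Suc n. alt i (act (bar_coeff G i xs) (f (bar_face G i xs))))
      = act (hd xs) (f (tl xs)) + (\<Sum>i=1..n. alt i (act (bar_coeff G i xs) (f (bar_face G i xs))))
        + alt (Suc n) (act (bar_coeff G (Suc n) xs) (f (bar_face G (Suc n) xs)))"
    unfolding sum.atMost_Suc[of _ n]
    by (simp add: sum.atMost_shift[of _ n] sum.atLeast1_atMost_eq)
      (simp add: alt_def bar_coeff_def bar_face_def)
  also have "(\<Sum>i=1..n. alt i (act (bar_coeff G i xs) (f (bar_face G i xs))))
      = (\<Sum>i=1..n. alt i (f (merge G i xs)))"
  proof (rule sum.cong[OF refl])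
    fix i assume i: "i \<in> {1..n}"
    then have "bar_face G i xs = merge G i xs" using l by (auto simp: bar_face_def)
    with mem[of i] i show "alt i (act (bar_coeff G i xs) (f (bar_face G i xs))) = alt i (f (merge G i xs))"
      by (auto simp: bar_coeff_def act_one)
  qed
  also have "act (bar_coeff G (Suc n) xs) (f (bar_face G (Suc n) xs)) = f (butlast xs)"
    using mem[of "Suc n"] l by (auto simp: bar_coeff_def act_one bar_face_def)
  finally show ?thesis using xs by (simp add: coboundary_def)
qed

lemma coboundary_mem:
  assumes f: "f \<in> cochains G M n"
  shows "coboundary G act n f \<in> cochains G M (Suc n)"
proof -
  have "coboundary G act n f xs \<in> M" if xs: "xs \<in> tuples G (Suc n)" for xs
    unfolding coboundary_eq[OF f xs] using f
    by (intro sum_mem alt_mem act_mem bar_coeff_mem[OF xs])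
      (auto simp: cochains_def bar_face_mem[OF xs])
  then show ?thesis by (auto simp: cochains_def coboundary_def)
qed

lemma coboundary_coboundary:
  assumes f: "f \<in> cochains G M n"
  shows "coboundary G act (Suc n) (coboundary G act n f) = 0"
proof (rule ext)
  fix xs
  show "coboundary G act (Suc n) (coboundary G act n f) xs = 0 xs"
  proof (cases "xs \<in> tuples G (Suc (Suc n))")
    case False
    then show ?thesis by (simp add: coboundary_def)
  next
    case xs: True
    define T where "T j i = act (bar_coeff G j xs \<otimes> bar_coeff G i (bar_face G j xs))
      (f (bar_face G i (bar_face G j xs)))" for j i
    have *: "alt j (act (bar_coeff G j xs) (coboundary G act n f (bar_face G j xs)))
        = (\<Sum>i\<le>Suc n. alt (j + i) (T j i))" if j: "j \<le> Suc (Suc n)" for j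
    proof -
      have fj: "bar_face G j xs \<in> tuples G (Suc n)" by (rule bar_face_mem[OF xs j])
      have fM: "f (bar_face G i (bar_face G j xs)) \<in> M" if "i \<le> Suc n" for i
        using f bar_face_mem[OF fj that] by (auto simp: cochains_def)
      let ?x = "\<lambda>i. act (bar_coeff G i (bar_face G j xs)) (f (bar_face G i (bar_face G j xs)))"
      have xM: "?x i \<in> M" if "i \<le> Suc n" for i
        using fM[OF that] bar_coeff_mem[OF fj] by (rule act_mem[rotated])
      have "act (bar_coeff G j xs) (\<Sum>i\<le>Suc n. alt i (?x i))
          = (\<Sum>i\<le>Suc n. act (bar_coeff G j xs) (alt i (?x i)))"
        by (rule act_sum[OF bar_coeff_mem[OF xs]]) (use xM in \<open>auto intro: alt_mem\<close>)
      also have "alt j \<dots> = (\<Sum>i\<le>Suc n. alt (j + i) (act (bar_coeff G j xs) (?x i)))"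
        unfolding alt_sum
        by (intro sum.cong refl) (use xM bar_coeff_mem[OF xs] in \<open>auto simp: act_alt alt_alt\<close>)
      also have "\<dots> = (\<Sum>i\<le>Suc n. alt (j + i) (T j i))"
        unfolding T_def
        by (intro sum.cong refl) (use fM bar_coeff_mem[OF xs] bar_coeff_mem[OF fj] in \<open>auto simp: act_mult\<close>)
      finally show ?thesis by (simp only: coboundary_eq[OF f fj])
    qed
    have "coboundary G act (Suc n) (coboundary G act n f) xs
        = (\<Sum>j\<le>Suc (Suc n). \<Sum>i\<le>Suc n. alt (j + i) (T j i))"
      unfolding coboundary_eq[OF coboundary_mem[OF f] xs] by (intro sum.cong refl *) simp
    also have "\<dots> = 0"
      by (rule alternating_double_sum)
        (simp add: T_def bar_face_bar_face[OF xs] bar_coeff_bar_coeff[OF xs])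
    finally show ?thesis by simp
  qed
qed

lemma coboundary_diff:
  assumes f: "f \<in> cochains G M n" and g: "g \<in> cochains G M n"
  shows "coboundary G act n (f - g) = coboundary G act n f - coboundary G act n g"
proof (rule ext)
  fix xs
  show "coboundary G act n (f - g) xs = (coboundary G act n f - coboundary G act n g) xs"
  proof (cases "xs \<in> tuples G (Suc n)")
    case True
    then have "hd xs \<in> carrier G" "tl xs \<in> tuples G n" by (cases xs; auto simp: tuples_def)+
    with f g show ?thesis
      by (auto simp: coboundary_def cochains_def act_diff alt_diff sum_subtractf)
  qed (simp add: coboundary_def)
qed

lemma cochain_complex_bar: "cochain_complex (cochains G M) (coboundary G act)"
  by unfold_locales
    (auto simp: coboundary_mem coboundary_diff coboundary_coboundary, auto simp: cochains_def zero_mem diff_mem)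

end

context group
begin

lemma trivial_module: "group_module G UNIV trivial_action"
  by unfold_locales (auto simp: trivial_action_def)

lemma linf_module: "group_module G (linf G :: ('a \<Rightarrow> 'r::linordered_idom) set) (linf_action G)"
proof unfold_locales
  fix f g :: "'a \<Rightarrow> 'r" assume "f \<in> linf G" "g \<in> linf G"
  then obtain c c' where "\<forall>h\<in>carrier G. \<bar>f h\<bar> \<le> c" "\<forall>h\<in>carrier G. \<bar>g h\<bar> \<le> c'"
    "\<forall>h. h \<notin> carrier G \<longrightarrow> f h = 0" "\<forall>h. h \<notin> carrier G \<longrightarrow> g h = 0"
    by (auto simp: linf_def)
  then show "f - g \<in> linf G"
    by (auto simp: linf_def intro!: exI[of _ "c + c'"] order_trans[OF abs_triangle_ineq4] add_mono)
next
  fix g and f :: "'a \<Rightarrow> 'r" assume g: "g \<in> carrier G" and "f \<in> linf G"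
  then obtain c where "\<forall>h\<in>carrier G. \<bar>f h\<bar> \<le> c" by (auto simp: linf_def)
  with g show "linf_action G g f \<in> linf G"
    by (auto simp: linf_def linf_action_def intro!: exI[of _ c])
next
  show "(0 :: 'a \<Rightarrow> 'r) \<in> linf G" by (auto simp: linf_def)
next
  fix g and f f' :: "'a \<Rightarrow> 'r"
  show "linf_action G g (f - f') = linf_action G g f - linf_action G g f'"
    by (rule ext) (simp add: linf_action_def)
next
  fix f :: "'a \<Rightarrow> 'r" assume "f \<in> linf G"
  then show "linf_action G \<one> f = f"
    by (intro ext) (simp add: linf_action_def linf_def)
next
  fix g h and f :: "'a \<Rightarrow> 'r" assume "g \<in> carrier G" "h \<in> carrier G"
  then show "linf_action G (g \<otimes> h) f = linf_action G g (linf_action G h f)"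
    by (intro ext) (simp add: linf_action_def inv_mult_group m_assoc)
qed

lemma cochain_complex_trivial:
  "cochain_complex (cochains G (UNIV :: 'm::ab_group_add set)) (coboundary G trivial_action)"
  by (rule group_module.cochain_complex_bar[OF trivial_module])

lemma cochain_complex_linf:
  "cochain_complex (cochains G (linf G :: ('a \<Rightarrow> 'r::linordered_idom) set)) (coboundary G (linf_action G))"
  by (rule group_module.cochain_complex_bar[OF linf_module])

lemma abs_alt: "\<bar>alt i x\<bar> = \<bar>x :: 'r::linordered_idom\<bar>"
  by (simp add: alt_def)

lemma bounded_coboundary:
  assumes f: "(f :: 'a list \<Rightarrow> 'r::linordered_idom) \<in> bounded_cochains G n"
  shows "coboundary G trivial_action n f \<in> bounded_cochains G (Suc n)"
proof -
  interpret group_module G "UNIV :: 'r set" trivial_action by (rule trivial_module)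
  have fc: "f \<in> cochains G UNIV n" using f by (simp add: bounded_cochains_def)
  obtain c where c: "\<And>xs. xs \<in> tuples G n \<Longrightarrow> \<bar>f xs\<bar> \<le> c"
    using f by (auto simp: bounded_cochains_def)
  have "\<bar>coboundary G trivial_action n f xs\<bar> \<le> (\<Sum>i\<le>Suc n. c)" if xs: "xs \<in> tuples G (Suc n)" for xs
    unfolding coboundary_eq[OF fc xs] trivial_action_def
    by (rule order_trans[OF sum_abs]) (auto intro!: sum_mono c bar_face_mem[OF xs] simp: abs_alt simp del: sum.atMost_Suc sum_constant)
  then show ?thesis using coboundary_mem[OF fc] unfolding bounded_cochains_def by blast
qed

lemma cochain_complex_bounded:
  "cochain_complex (bounded_cochains G :: nat \<Rightarrow> ('a list \<Rightarrow> 'r::linordered_idom) set)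
     (coboundary G trivial_action)"
proof -
  interpret C: cochain_complex "cochains G (UNIV :: 'r set)" "coboundary G trivial_action"
    by (rule cochain_complex_trivial)
  have sub: "f \<in> cochains G UNIV n" if "f \<in> bounded_cochains G n" for f :: "'a list \<Rightarrow> 'r" and n
    using that by (simp add: bounded_cochains_def)
  show ?thesis
  proof unfold_locales
    show "(0 :: 'a list \<Rightarrow> 'r) \<in> bounded_cochains G n" for n
      using C.zero_mem[of n] by (auto simp: bounded_cochains_def)
    fix n and f g :: "'a list \<Rightarrow> 'r"
    assume f: "f \<in> bounded_cochains G n"
    show "coboundary G trivial_action n f \<in> bounded_cochains G (Suc n)"
      by (rule bounded_coboundary[OF f])
    show "coboundary G trivial_action (Suc n) (coboundary G trivial_action n f) = 0"
      by (rule C.d_d[OF sub[OF f]])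
    assume g: "g \<in> bounded_cochains G n"
    show "coboundary G trivial_action n (f - g)
        = coboundary G trivial_action n f - coboundary G trivial_action n g"
      by (rule C.d_diff[OF sub[OF f] sub[OF g]])
    obtain c c' where "\<forall>xs\<in>tuples G n. \<bar>f xs\<bar> \<le> c" "\<forall>xs\<in>tuples G n. \<bar>g xs\<bar> \<le> c'"
      using f g by (auto simp: bounded_cochains_def)
    then have "\<forall>xs\<in>tuples G n. \<bar>(f - g) xs\<bar> \<le> c + c'"
      by (auto intro!: order_trans[OF abs_triangle_ineq4] add_mono)
    then show "f - g \<in> bounded_cochains G n"
      using C.diff_mem[OF sub[OF f] sub[OF g]] unfolding bounded_cochains_def by blast
  qed
qed

lemma comparison_map_hom:
  "comparison_map G n \<in> hom (bounded_cohomology G n)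
     (group_cohomology G n :: ('a list \<Rightarrow> 'r::linordered_idom) set monoid)"
  unfolding comparison_map_def bounded_cohomology_def group_cohomology_def
  by (rule cohomology_map_hom[OF cochain_complex_bounded cochain_complex_trivial])
    (auto simp: bounded_cochains_def)

lemma iota_map_hom:
  "iota_map G n \<in> hom (group_cohomology G n :: ('a list \<Rightarrow> 'r::linordered_idom) set monoid)
     (linf_cohomology G n)"
  unfolding iota_map_def linf_cohomology_def group_cohomology_def
proof (rule cohomology_map_hom[OF cochain_complex_trivial cochain_complex_linf], goal_cases)
  case (1 m f)
  then show ?case by (auto simp: cochains_def linf_def const_fun_def fun_eq_iff)
next
  case (2 m f g)
  then show ?case by (auto simp: const_fun_def fun_eq_iff)
next
  case (3 m f)
  interpret U: group_module G "UNIV :: 'r set" trivial_action by (rule trivial_module)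
  interpret L: group_module G "linf G :: ('a \<Rightarrow> 'r) set" "linf_action G" by (rule linf_module)
  have alt: "const_fun G (alt i x) = alt i (const_fun G x)" for i and x :: 'r
    by (auto simp: alt_def const_fun_def fun_eq_iff)
  have add: "const_fun G (x + y) = const_fun G x + const_fun G y" for x y :: 'r
    by (auto simp: const_fun_def fun_eq_iff)
  have zero: "const_fun G (0 :: 'r) = 0"
    by (auto simp: const_fun_def fun_eq_iff)
  have sum: "const_fun G (sum k I) = (\<Sum>i\<in>I. const_fun G (k i))" for k :: "nat \<Rightarrow> 'r" and I
    by (induction I rule: infinite_finite_induct) (auto simp: add zero)
  have act: "linf_action G g (const_fun G x) = const_fun G x" if "g \<in> carrier G" for g and x :: 'r
    using that by (auto simp: linf_action_def const_fun_def fun_eq_iff)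
  show ?case
  proof (rule ext)
    fix xs
    show "const_fun G (coboundary G trivial_action m f xs)
        = coboundary G (linf_action G) m (\<lambda>xs. const_fun G (f xs)) xs"
    proof (cases "xs \<in> tuples G (Suc m)")
      case True
      then have "hd xs \<in> carrier G" by (cases xs) (auto simp: tuples_def)
      with True show ?thesis
        by (simp add: coboundary_def add sum alt act trivial_action_def)
    qed (simp add: coboundary_def zero)
  qed
qed

end

end

theory Submission
  imports Defs "HOL-Library.Countable_Set"
begin

text \<open>Let \<open>K = \<langle>a, b, c | cba = ab, c\<^sup>4\<rangle>\<close>, mapped to \<open>SL\<^sub>2(\<real>)\<close> as the group of a hyperbolic torus with a cone point, and
  \<open>G = K \<times> \<int>\<^sup>m\<close> with \<open>m = n - 2\<close>. The orientation cocycle \<open>B\<close> of the action on the projective line is bounded, and it does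
  not vanish on some 2-cycle \<open>z\<close> of \<open>K\<close>. With the projections \<open>t\<^sub>j : G \<rightarrow> \<int>\<close>, the cocycle
  \<open>\<omega> = B \<union> t\<^sub>1 \<union> \<dots> \<union> t\<^sub>m\<close> is bounded in its first argument once the others are fixed. Then
  \<open>(g\<^sub>1, \<dots>) \<mapsto> (h \<mapsto> \<omega>(h\<^sup>-\<^sup>1, g\<^sub>1, \<dots>))\<close> is a cochain with values in \<open>\<ell>\<^sup>\<infinity>\<close> and its coboundary is \<open>\<omega>\<close>, so \<open>\<iota>[\<omega>] = 0\<close>.
  The class \<open>[\<omega>]\<close> is not bounded: \<open>z \<times> (k-fold circle) \<times> torus\<close> can be represented by cycles whose norm does not
  depend on \<open>k\<close>, while \<open>\<omega>\<close> grows linearly in \<open>k\<close> on them. In place of these product cycles, \<open>\<omega>\<close> is contracted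
  successively with central elements.\<close>

section \<open>Cochains with trivial coefficients\<close>

definition insert_at :: "nat \<Rightarrow> 'a \<Rightarrow> 'a list \<Rightarrow> 'a list" where
  "insert_at i x xs = take i xs @ x # drop i xs"

lemma length_insert_at [simp]: "length (insert_at i x xs) = Suc (length xs)"
  by (simp add: insert_at_def)

lemma nth_insert_at:
  assumes "i \<le> length xs"
  shows "insert_at i x xs ! k = (if k < i then xs ! k else if k = i then x else xs ! (k - 1))"
  using assms by (cases "k - i") (auto simp: insert_at_def nth_append min_def)

text \<open>The index \<open>n\<close> is the degree of the result, one below the degree of
  \<open>f\<close>.\<close>

definition contraction ::
    "('a, 'k) monoid_scheme \<Rightarrow> 'a \<Rightarrow> nat \<Rightarrow> ('a list \<Rightarrow> 'm::ab_group_add) \<Rightarrow> 'a list \<Rightarrow> 'm" where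
  "contraction G s n f = (\<lambda>xs. if xs \<in> tuples G n then \<Sum>i\<le>n. alt i (f (insert_at i s xs)) else 0)"

text \<open>\<open>t\<close> is integer-valued so that one definition serves both coefficient
  rings.\<close>

definition cup_hom ::
    "('a, 'k) monoid_scheme \<Rightarrow> nat \<Rightarrow> ('a list \<Rightarrow> 'r::comm_ring_1) \<Rightarrow> ('a \<Rightarrow> int) \<Rightarrow> 'a list \<Rightarrow> 'r" where
  "cup_hom G n f t = (\<lambda>xs. if xs \<in> tuples G (Suc n) then f (butlast xs) * of_int (t (last xs)) else 0)"

lemma alt_add: "alt i (x + y) = alt i x + alt i y"
  by (simp add: alt_def)

lemma alt_mult_right: "alt i (x * y) = alt i x * (y :: 'r::comm_ring_1)"
  by (simp add: alt_def)

lemma alt_Suc: "alt (Suc i) x = - alt i x"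
  by (simp add: alt_def)

context group
begin

lemma coboundary_trivial:
  assumes "f \<in> cochains G UNIV n" "xs \<in> tuples G (Suc n)"
  shows "coboundary G trivial_action n f xs = (\<Sum>i\<le>Suc n. alt i (f (bar_face G i xs)))"
  using group_module.coboundary_eq[OF trivial_module assms] by (simp add: trivial_action_def)

section \<open>Faces of a tuple with an inserted entry\<close>

lemma insert_at_mem:
  assumes "s \<in> carrier G" "xs \<in> tuples G n"
  shows "insert_at i s xs \<in> tuples G (Suc n)"
  using assms set_take_subset[of i xs] set_drop_subset[of i xs]
  by (auto simp: tuples_def insert_at_def)

lemma contraction_mem: "contraction G s n f \<in> cochains G UNIV n"
  by (simp add: cochains_def contraction_def)

text \<open>The face \<open>j\<close> drops entry 0 or multiplies the entries \<open>j - 1\<close>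
  and \<open>j\<close>, all of which precede the inserted one; this moves the inserted entry one
  place to the left.\<close>

lemma face_insert_low:
  assumes "j < i" "i \<le> Suc n" "length xs = Suc n"
  shows "bar_face G j (insert_at i s xs) = insert_at (i - 1) s (bar_face G j xs)"
proof (rule nth_equalityI)
  have l: "length (bar_face G j (insert_at i s xs)) = Suc n" "length (bar_face G j xs) = n"
    using assms length_bar_face[of j "insert_at i s xs" G] length_bar_face[of j xs G]
    by (force simp: insert_at_def)+
  then show "length (bar_face G j (insert_at i s xs)) = length (insert_at (i - 1) s (bar_face G j xs))"
    by simp
  fix k assume "k < length (bar_face G j (insert_at i s xs))"
  then have k: "k < Suc n" using l by simp
  have R: "bar_face G j xs ! m = (if Suc m < j then xs ! m
      else if Suc m = j then xs ! m \<otimes> xs ! Suc m else xs ! Suc m)" if "m < n" for m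
    using that assms by (intro nth_bar_face) auto
  have L: "bar_face G j (insert_at i s xs) ! k = (if Suc k < j then insert_at i s xs ! k
      else if Suc k = j then insert_at i s xs ! k \<otimes> insert_at i s xs ! Suc k
      else insert_at i s xs ! Suc k)"
    using k assms by (intro nth_bar_face) auto
  obtain p where p: "i = Suc p" using assms(1) by (cases i) auto
  show "bar_face G j (insert_at i s xs) ! k = insert_at (i - 1) s (bar_face G j xs) ! k"
  proof (cases "k < p")
    case True
    then show ?thesis unfolding L using p assms k l by (simp add: R nth_insert_at)
  next
    case False
    show ?thesis
    proof (cases "k = p")
      case True
      then show ?thesis unfolding L using p assms k l by (simp add: nth_insert_at)
    next
      case F2: False
      then obtain q where "k = Suc q" "p \<le> q" using False by (cases k) auto
      then show ?thesis unfolding L using p assms k l by (simp add: R nth_insert_at)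
    qed
  qed
qed

text \<open>Here the face acts only behind the inserted entry, which keeps its position.\<close>

lemma face_insert_high:
  assumes "Suc i < j" "j \<le> Suc (Suc n)" "length xs = Suc n"
  shows "bar_face G j (insert_at i s xs) = insert_at i s (bar_face G (j - 1) xs)"
proof (rule nth_equalityI)
  obtain p where p: "j = Suc p" using assms(1) by (cases j) auto
  have l: "length (bar_face G j (insert_at i s xs)) = Suc n" "length (bar_face G p xs) = n"
    using assms p length_bar_face[of j "insert_at i s xs" G] length_bar_face[of p xs G]
    by (force simp: insert_at_def)+
  then show "length (bar_face G j (insert_at i s xs)) = length (insert_at i s (bar_face G (j - 1) xs))"
    by (simp add: p)
  fix k assume "k < length (bar_face G j (insert_at i s xs))"
  then have k: "k < Suc n" using l by simp
  have R: "bar_face G p xs ! m = (if Suc m < p then xs ! m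
      else if Suc m = p then xs ! m \<otimes> xs ! Suc m else xs ! Suc m)" if "m < n" for m
    using that assms p by (intro nth_bar_face) auto
  have L: "bar_face G j (insert_at i s xs) ! k = (if Suc k < j then insert_at i s xs ! k
      else if Suc k = j then insert_at i s xs ! k \<otimes> insert_at i s xs ! Suc k
      else insert_at i s xs ! Suc k)"
    using k assms by (intro nth_bar_face) auto
  consider "k < i" | "k = i" | q where "k = Suc q" "i \<le> q" by (cases k; force)
  then show "bar_face G j (insert_at i s xs) ! k = insert_at i s (bar_face G (j - 1) xs) ! k"
    unfolding L by cases (use p assms k l in \<open>auto simp: R nth_insert_at\<close>)
qed

text \<open>Both sides multiply \<open>s\<close> with \<open>xs ! i\<close>, in the two possible
  orders.\<close>

lemma face_insert_swap:
  assumes "i \<le> n" "length xs = Suc n" "s \<otimes> xs ! i = xs ! i \<otimes> s"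
  shows "bar_face G (Suc i) (insert_at i s xs) = bar_face G (Suc i) (insert_at (Suc i) s xs)"
proof (rule nth_equalityI)
  have l: "length (bar_face G (Suc i) (insert_at i' s xs)) = Suc n" for i'
    using assms length_bar_face[of "Suc i" "insert_at i' s xs" G] by (force simp: insert_at_def)
  then show "length (bar_face G (Suc i) (insert_at i s xs)) = length (bar_face G (Suc i) (insert_at (Suc i) s xs))"
    by simp
  fix k assume "k < length (bar_face G (Suc i) (insert_at i s xs))"
  then have k: "k < Suc n" using l by simp
  have L: "bar_face G (Suc i) (insert_at i' s xs) ! k = (if Suc k < Suc i then insert_at i' s xs ! k
      else if Suc k = Suc i then insert_at i' s xs ! k \<otimes> insert_at i' s xs ! Suc k
      else insert_at i' s xs ! Suc k)" for i'
    using k assms by (intro nth_bar_face) auto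
  show "bar_face G (Suc i) (insert_at i s xs) ! k = bar_face G (Suc i) (insert_at (Suc i) s xs) ! k"
    using assms by (auto simp: L nth_insert_at)
qed

lemma face_insert_first: "bar_face G 0 (insert_at 0 s xs) = xs"
  by (simp add: bar_face_def insert_at_def)

lemma face_insert_last: "length xs = Suc n \<Longrightarrow> bar_face G (Suc (Suc n)) (insert_at (Suc n) s xs) = xs"
  by (simp add: bar_face_def insert_at_def butlast_append)

text \<open>The contraction is the adjoint of the shuffle product with the 1-cycle \<open>[s]\<close>.\<close>

lemma contraction_coboundary:
  fixes f :: "'a list \<Rightarrow> 'm::ab_group_add"
  assumes s: "s \<in> carrier G" "\<And>g. g \<in> carrier G \<Longrightarrow> s \<otimes> g = g \<otimes> s"
    and f: "f \<in> cochains G UNIV (Suc n)"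
  shows "contraction G s (Suc n) (coboundary G trivial_action (Suc n) f)
    = - coboundary G trivial_action n (contraction G s n f)"
proof (rule ext)
  fix xs
  show "contraction G s (Suc n) (coboundary G trivial_action (Suc n) f) xs
    = (- coboundary G trivial_action n (contraction G s n f)) xs"
  proof (cases "xs \<in> tuples G (Suc n)")
    case False
    then show ?thesis by (simp add: contraction_def coboundary_def)
  next
    case xs: True
    then have l: "length xs = Suc n" and car: "\<And>i. i \<le> n \<Longrightarrow> xs ! i \<in> carrier G"
      by (auto simp: tuples_iff)
    define T where "T i j = f (bar_face G j (insert_at i s xs))" for i j
    define W where "W j i = f (insert_at i s (bar_face G j xs))" for i j
    let ?f = "\<lambda>(i, j). alt (i + j) (T i j)" and ?g = "\<lambda>(j, i). alt (j + i) (W j i)"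
    \<comment> \<open>On \<open>?L\<close> and \<open>?U\<close> the face \<open>j\<close> leaves
      the entry inserted at \<open>i\<close> alone. On \<open>?D\<close> and \<open>?E\<close> it
      multiplies that entry into a neighbour, or drops it at an end of the tuple.\<close>
    let ?L = "{(i, j). j < i \<and> i \<le> Suc n}" and ?D = "(\<lambda>i. (i, i)) ` {..Suc n}"
      and ?E = "(\<lambda>i. (i, Suc i)) ` {..Suc n}" and ?U = "{(i, j). Suc i < j \<and> j \<le> Suc (Suc n)}"
    have fin: "finite ?L" "finite ?U"
      by (rule finite_subset[of _ "{..Suc (Suc n)} \<times> {..Suc (Suc n)}"]; force)+
    have "contraction G s (Suc n) (coboundary G trivial_action (Suc n) f) xs
        = (\<Sum>i\<le>Suc n. \<Sum>j\<le>Suc (Suc n). alt (i + j) (T i j))"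
      using xs by (simp add: contraction_def coboundary_trivial[OF f] insert_at_mem[OF s(1)] alt_sum
          alt_alt T_def del: sum.atMost_Suc)
    also have "\<dots> = sum ?f ({..Suc n} \<times> {..Suc (Suc n)})"
      by (simp add: sum.cartesian_product del: sum.atMost_Suc)
    also have "{..Suc n} \<times> {..Suc (Suc n)} = (?L \<union> ?U) \<union> (?D \<union> ?E)"
      by (auto simp: image_iff)
    also have "sum ?f \<dots> = (sum ?f ?L + sum ?f ?U) + (sum ?f ?D + sum ?f ?E)"
      using fin by (subst sum.union_disjoint; (subst sum.union_disjoint)?; (subst sum.union_disjoint)?)
        (auto simp del: sum.atMost_Suc)
    \<comment> \<open>Since \<open>s\<close> is central, the terms of \<open>?E\<close> and
      \<open>?D\<close> cancel in pairs, shifted by one. The two terms left over are both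
      \<open>f xs\<close>, with opposite signs.\<close>
    also have "sum ?f ?D + sum ?f ?E = 0"
    proof -
      have D: "sum ?f ?D = (\<Sum>i\<le>Suc n. T i i)"
        by (subst sum.reindex) (auto simp: inj_on_def alt_def simp del: sum.atMost_Suc)
      have E: "sum ?f ?E = (\<Sum>i\<le>Suc n. - T i (Suc i))"
        by (subst sum.reindex) (auto simp: inj_on_def alt_def simp del: sum.atMost_Suc)
      have "T i (Suc i) = T (Suc i) (Suc i)" if "i \<le> n" for i
        using face_insert_swap[OF that l] s(2) car[OF that] by (simp add: T_def)
      then have "(\<Sum>i\<le>n. T i (Suc i)) = (\<Sum>i\<le>n. T (Suc i) (Suc i))" by simp
      moreover have "T 0 0 = f xs" by (simp add: T_def face_insert_first)
      moreover have "T (Suc n) (Suc (Suc n)) = f xs" by (simp add: T_def face_insert_last[OF l])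
      ultimately show ?thesis
        unfolding D E by (subst sum.atMost_Suc_shift) (simp add: sum_negf)
    qed
    \<comment> \<open>Exchanging face and insertion lowers \<open>i\<close> by one on
      \<open>?L\<close> and \<open>j\<close> by one on \<open>?U\<close>; hence the minus
      signs.\<close>
    also have "sum ?f ?L = (\<Sum>p\<in>{(j, i). j \<le> i \<and> i \<le> n}. - ?g p)"
    proof (rule sum.reindex_bij_witness[where i = "\<lambda>(j, i). (Suc i, j)" and j = "\<lambda>(i, j). (j, i - 1)"],
        goal_cases)
      case (5 p)
      then obtain i j where p: "p = (i, j)" "j < i" "i \<le> Suc n" by auto
      then obtain k where "i = Suc k" by (cases i) auto
      with p face_insert_low[OF p(2,3) l] show ?case by (auto simp: alt_def T_def W_def)
    qed auto
    also have "sum ?f ?U = (\<Sum>p\<in>{(j, i). i < j \<and> j \<le> Suc n}. - ?g p)"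
    proof (rule sum.reindex_bij_witness[where i = "\<lambda>(j, i). (i, Suc j)" and j = "\<lambda>(i, j). (j - 1, i)"],
        goal_cases)
      case (5 p)
      then obtain i j where p: "p = (i, j)" "Suc i < j" "j \<le> Suc (Suc n)" by auto
      then obtain k where "j = Suc k" by (cases j) auto
      with p face_insert_high[OF p(2,3) l] show ?case by (auto simp: alt_def T_def W_def)
    qed auto
    also have "(\<Sum>p\<in>{(j, i). j \<le> i \<and> i \<le> n}. - ?g p) + (\<Sum>p\<in>{(j, i). i < j \<and> j \<le> Suc n}. - ?g p) + 0
        = (\<Sum>p\<in>{(j, i). j \<le> i \<and> i \<le> n} \<union> {(j, i). i < j \<and> j \<le> Suc n}. - ?g p)"
      unfolding add_0_right
      by (rule sum.union_disjoint[symmetric];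
          (rule finite_subset[of _ "{..Suc n} \<times> {..Suc n}"])?; force)
    also have "{(j, i). j \<le> i \<and> i \<le> n} \<union> {(j, i). i < j \<and> j \<le> Suc n} = {..Suc n} \<times> {..n}"
      by auto
    also have "(\<Sum>p\<in>{..Suc n} \<times> {..n}. - ?g p) = - (\<Sum>j\<le>Suc n. \<Sum>i\<le>n. alt (j + i) (W j i))"
      by (simp add: sum.cartesian_product sum_negf del: sum.atMost_Suc)
    also have "(\<Sum>j\<le>Suc n. \<Sum>i\<le>n. alt (j + i) (W j i))
        = coboundary G trivial_action n (contraction G s n f) xs"
      unfolding coboundary_trivial[OF contraction_mem xs]
      by (intro sum.cong refl)
        (simp add: contraction_def bar_face_mem[OF xs] alt_sum alt_alt W_def)
    finally show ?thesis by simp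
  qed
qed

text \<open>The factor counts the places for the insertion. The bound is the same for all
  \<open>s\<close>, which later runs through the powers of a central generator.\<close>

lemma contraction_bound:
  fixes f :: "'a list \<Rightarrow> 'r::linordered_idom"
  assumes "s \<in> carrier G" and "\<And>xs. xs \<in> tuples G (Suc n) \<Longrightarrow> \<bar>f xs\<bar> \<le> C" and "xs \<in> tuples G n"
  shows "\<bar>contraction G s n f xs\<bar> \<le> of_nat (Suc n) * C"
proof -
  have "\<bar>contraction G s n f xs\<bar> \<le> (\<Sum>i\<le>n. \<bar>f (insert_at i s xs)\<bar>)"
    using assms(3) sum_abs[of "\<lambda>i. alt i (f (insert_at i s xs))" "{..n}"]
    by (simp add: contraction_def abs_alt)
  also have "\<dots> \<le> (\<Sum>i\<le>n. C)"
    by (intro sum_mono assms(2) insert_at_mem assms(1,3))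
  finally show ?thesis by simp
qed

text \<open>Every insertion but the last one puts \<open>s\<close> among the arguments of
  \<open>f\<close>, where \<open>f\<close> vanishes; the last one feeds \<open>s\<close> to
  \<open>t\<close>.\<close>

lemma contraction_cup_hom:
  fixes f :: "'a list \<Rightarrow> 'r::comm_ring_1"
  assumes s: "s \<in> carrier G" and f: "f \<in> cochains G UNIV n"
    and vanish: "\<And>xs. s \<in> set xs \<Longrightarrow> f xs = 0"
  shows "contraction G s n (cup_hom G n f t) = (\<lambda>xs. alt n (of_int (t s)) * f xs)"
proof (rule ext)
  fix xs
  show "contraction G s n (cup_hom G n f t) xs = alt n (of_int (t s)) * f xs"
  proof (cases "xs \<in> tuples G n")
    case False
    then show ?thesis using f by (auto simp: contraction_def cochains_def)
  next
    case xs: True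
    have l: "length xs = n" using xs by (simp add: tuples_def)
    have 0: "alt i (cup_hom G n f t (insert_at i s xs)) = 0" if "i < n" for i
    proof -
      have "drop i xs \<noteq> []" using that l by simp
      then have "s \<in> set (butlast (insert_at i s xs))"
        by (simp add: insert_at_def butlast_append)
      then show ?thesis
        by (simp add: vanish cup_hom_def alt_def)
    qed
    have "(\<Sum>i\<le>n. alt i (cup_hom G n f t (insert_at i s xs))) = alt n (cup_hom G n f t (insert_at n s xs))"
      using 0 by (subst sum.mono_neutral_right[of "{..n}" "{n}"]) auto
    moreover have "insert_at n s xs = xs @ [s]" using l by (simp add: insert_at_def)
    ultimately show ?thesis
      using xs s insert_at_mem[OF s xs, of n]
      by (simp add: contraction_def cup_hom_def alt_def mult.commute)
  qed
qed

section \<open>Cup products of cocycles with homomorphisms\<close>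

lemma cup_hom_mem: "cup_hom G n f t \<in> cochains G UNIV (Suc n)"
  by (simp add: cochains_def cup_hom_def)

lemma bar_face_append:
  assumes "i \<le> length xs" "xs \<noteq> []"
  shows "bar_face G i (xs @ [y]) = (if i = length xs then butlast xs @ [last xs \<otimes> y] else bar_face G i xs @ [y])"
proof (cases "i = length xs")
  case True
  obtain zs z where "xs = zs @ [z]" using assms(2) by (cases xs rule: rev_cases) auto
  with True show ?thesis by (simp add: bar_face_def merge_def nth_append)
next
  case False
  with assms show ?thesis
    by (cases i) (auto simp: bar_face_def merge_def nth_append)
qed

text \<open>The Leibniz rule with both factors closed.\<close>

lemma cup_hom_cocycle:
  fixes f :: "'a list \<Rightarrow> 'r::comm_ring_1"
  assumes f: "f \<in> cochains G UNIV n" and df: "coboundary G trivial_action n f = 0"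
    and t: "\<And>g h. g \<in> carrier G \<Longrightarrow> h \<in> carrier G \<Longrightarrow> t (g \<otimes> h) = t g + t h"
  shows "coboundary G trivial_action (Suc n) (cup_hom G n f t) = 0"
proof (rule ext)
  fix zs
  show "coboundary G trivial_action (Suc n) (cup_hom G n f t) zs = 0 zs"
  proof (cases "zs \<in> tuples G (Suc (Suc n))")
    case False
    then show ?thesis by (simp add: coboundary_def)
  next
    case zs: True
    then obtain xs y where z: "zs = xs @ [y]" by (cases zs rule: rev_cases) (auto simp: tuples_def)
    with zs have xs: "xs \<in> tuples G (Suc n)" and y: "y \<in> carrier G" by (auto simp: tuples_def)
    then obtain ws x where x: "xs = ws @ [x]" by (cases xs rule: rev_cases) (auto simp: tuples_def)
    with xs have ws: "ws \<in> tuples G n" and xc: "x \<in> carrier G" by (auto simp: tuples_def)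
    have l: "length xs = Suc n" using xs by (simp add: tuples_def)
    let ?F = "cup_hom G n f t"
    have m: "zs' \<in> tuples G (Suc n) \<Longrightarrow> ?F zs' = f (butlast zs') * of_int (t (last zs'))" for zs'
      by (simp add: cup_hom_def)
    \<comment> \<open>Here \<open>zs = ws @ [x, y]\<close>. The faces up to \<open>n\<close> act
      inside \<open>xs\<close> and leave the factor \<open>t y\<close>, the next one produces
      \<open>t (x \<otimes> y)\<close>, and the last one drops \<open>y\<close>.\<close>
    have low: "alt i (?F (bar_face G i zs)) = alt i (f (bar_face G i xs)) * of_int (t y)" if "i \<le> n" for i
      using that l bar_face_mem[OF zs, of i] bar_face_append[of i xs y]
      by (simp add: z m alt_mult_right x)
    have "bar_face G (Suc n) zs = ws @ [x \<otimes> y]"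
      using l bar_face_append[of "Suc n" xs y] by (simp add: z x)
    then have mid: "?F (bar_face G (Suc n) zs) = f ws * (of_int (t x) + of_int (t y))"
      using bar_face_mem[OF zs, of "Suc n"] by (simp add: m t xc y)
    have top: "?F (bar_face G (Suc (Suc n)) zs) = f ws * of_int (t x)"
      using bar_face_mem[OF zs, of "Suc (Suc n)"] l by (simp add: m z x bar_face_def butlast_append)
    \<comment> \<open>Closedness of \<open>f\<close> at \<open>xs\<close> reduces the sum over the
      faces up to \<open>n\<close> to the value at \<open>ws\<close>, so that the terms with
      \<open>t y\<close> cancel.\<close>
    have "0 = coboundary G trivial_action n f xs * of_int (t y)" by (simp add: df)
    also have "\<dots> = (\<Sum>i\<le>n. alt i (f (bar_face G i xs))) * of_int (t y)
        + alt (Suc n) (f ws) * of_int (t y)"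
      unfolding coboundary_trivial[OF f xs] using l by (simp add: algebra_simps bar_face_def x)
    finally have "(\<Sum>i\<le>n. alt i (f (bar_face G i xs))) * of_int (t y) = alt n (f ws) * of_int (t y)"
      by (simp add: alt_Suc algebra_simps)
    moreover have "coboundary G trivial_action (Suc n) ?F zs
        = (\<Sum>i\<le>n. alt i (f (bar_face G i xs))) * of_int (t y)
          + alt (Suc n) (f ws * (of_int (t x) + of_int (t y))) + alt n (f ws * of_int (t x))"
      unfolding coboundary_trivial[OF cup_hom_mem zs]
      by (simp add: low mid top sum_distrib_right alt_Suc)
    ultimately show ?thesis by (cases "even n"; simp add: alt_def algebra_simps)
  qed
qed

end

section \<open>Weakly bounded classes\<close>

context cochain_complex
begin

section \<open>Classes and their representatives\<close>

lemma carrier_cohomology: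
  "carrier (cohomology C d n) = (\<lambda>f. coboundaries C d n #>\<^bsub>cocycle_group C d n\<^esub> f) ` carrier (cocycle_group C d n)"
  by (simp add: cohomology_def carrier_FactGroup)

lemma cocycle_mem_class:
  assumes "f \<in> carrier (cocycle_group C d n)"
  shows "f \<in> coboundaries C d n #>\<^bsub>cocycle_group C d n\<^esub> f"
  using group.rcos_self[OF comm_group.axioms(2)[OF comm_group_cocycles] assms
      normal_imp_subgroup[OF coboundaries_normal]] .

lemma coset_eq_coboundaries:
  assumes "X \<in> carrier (cohomology C d n)" "f \<in> X" "f \<in> coboundaries C d n"
  shows "X = coboundaries C d n"
proof -
  interpret Z: comm_group "cocycle_group C d n" by (rule comm_group_cocycles)
  have sub: "subgroup (coboundaries C d n) (cocycle_group C d n)"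
    by (rule normal_imp_subgroup[OF coboundaries_normal])
  obtain g where g: "g \<in> carrier (cocycle_group C d n)" "X = coboundaries C d n #>\<^bsub>cocycle_group C d n\<^esub> g"
    using assms(1) by (auto simp: carrier_cohomology)
  have "coboundaries C d n #>\<^bsub>cocycle_group C d n\<^esub> g = coboundaries C d n #>\<^bsub>cocycle_group C d n\<^esub> f"
    using Z.repr_independence[OF _ g(1) sub] assms(2) g(2) by simp
  then show ?thesis using g(2) Z.coset_join2[OF _ sub] assms(3) subgroup.subset[OF sub] by auto
qed

end

context group
begin

section \<open>Vanishing in the \<open>linf\<close> complex and failure of exactness\<close>

lemma merge_Cons: "merge G (Suc (Suc i)) (x # xs) = x # merge G (Suc i) xs"
  by (simp add: merge_def)

text \<open>The cocycle identity for \<open>f\<close> at \<open>inv h # xs\<close>, read as an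
  identity between functions of \<open>h\<close>, is the coboundary formula for the primitive
  \<open>F\<close>.\<close>

lemma const_coboundary_of_weakly_bounded:
  fixes f :: "'a list \<Rightarrow> 'r::linordered_idom"
  assumes f: "f \<in> cochains G UNIV (Suc n)" and df: "coboundary G trivial_action (Suc n) f = 0"
    and bound: "\<And>xs. xs \<in> tuples G n \<Longrightarrow> \<exists>c. \<forall>g\<in>carrier G. \<bar>f (g # xs)\<bar> \<le> c"
  shows "(\<lambda>xs. const_fun G (f xs)) \<in> coboundaries (cochains G (linf G)) (coboundary G (linf_action G)) (Suc n)"
proof -
  \<comment> \<open>The inverse matches the action on \<open>linf G\<close>:
    \<open>inv (inv g \<otimes> h) = inv h \<otimes> g\<close>. The hypothesis \<open>bound\<close>
    is what puts \<open>F xs\<close> into \<open>linf G\<close>.\<close>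
  define F where "F xs = (\<lambda>h. if xs \<in> tuples G n \<and> h \<in> carrier G then f (inv h # xs) else 0)" for xs
  have "F xs \<in> linf G" if "xs \<in> tuples G n" for xs
    using bound[OF that] that by (auto simp: linf_def F_def)
  then have "F \<in> cochains G (linf G) n"
    by (auto simp: cochains_def F_def)
  moreover have "coboundary G (linf_action G) n F = (\<lambda>xs. const_fun G (f xs))"
  proof (intro ext)
    fix xs h
    have alt_app: "alt i q h = alt i (q h)" for i and q :: "'a \<Rightarrow> 'r" by (simp add: alt_def)
    have sum_app: "(\<Sum>i\<in>I. q i) h = (\<Sum>i\<in>I. q i h)" for I and q :: "nat \<Rightarrow> 'a \<Rightarrow> 'r"
      by (induction I rule: infinite_finite_induct) auto
    have alt_zero: "alt i (0 :: 'r) = 0" for i by (simp add: alt_def)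
    show "coboundary G (linf_action G) n F xs h = const_fun G (f xs) h"
    proof (cases "xs \<in> tuples G (Suc n) \<and> h \<in> carrier G")
      case False
      then show ?thesis using f
        by (auto simp: coboundary_def const_fun_def cochains_def linf_action_def F_def alt_app sum_app alt_zero)
    next
      case True
      then obtain g ys where xs: "xs = g # ys" "g \<in> carrier G" "ys \<in> tuples G n" and h: "h \<in> carrier G"
        by (cases xs) (auto simp: tuples_def)
      let ?h = "inv h"
      have hx: "?h # xs \<in> tuples G (Suc (Suc n))" using True by (auto simp: tuples_def)
      have mt: "merge G i xs \<in> tuples G n" if "i \<in> {1..n}" for i
        using bar_face_mem[of xs n i] True that by (simp add: bar_face_def tuples_def)
      have bt: "butlast xs \<in> tuples G n"
        using True by (auto simp: tuples_def dest: in_set_butlastD)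
      \<comment> \<open>The first face is \<open>f xs\<close>, the second becomes the translate of
        \<open>F ys\<close> by \<open>g\<close>, and the others are faces of \<open>xs\<close>
        behind \<open>?h\<close>, with their signs reversed.\<close>
      have "coboundary G trivial_action (Suc n) f (?h # xs) = 0" by (simp add: df)
      then have "0 = f xs + (\<Sum>i=1..Suc n. alt i (f (merge G i (?h # xs))))
          + alt (Suc (Suc n)) (f (?h # butlast xs))"
        using hx xs by (simp add: coboundary_def trivial_action_def)
      also have "(\<Sum>i=1..Suc n. alt i (f (merge G i (?h # xs))))
          = - f ((?h \<otimes> g) # ys) + (\<Sum>i=1..n. alt (Suc i) (f (merge G (Suc i) (?h # xs))))"
      proof -
        have "merge G (Suc 0) (?h # xs) = (?h \<otimes> g) # ys" by (simp add: merge_def xs)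
        then show ?thesis
          by (subst sum.atLeast_Suc_atMost, simp)
            (simp add: sum.shift_bounds_cl_Suc_ivl alt_def del: sum.cl_ivl_Suc)
      qed
      also have "(\<Sum>i=1..n. alt (Suc i) (f (merge G (Suc i) (?h # xs)))) = (\<Sum>i=1..n. - alt i (f (?h # merge G i xs)))"
      proof (rule sum.cong[OF refl])
        fix i assume "i \<in> {1..n}"
        then obtain j where "i = Suc j" by (cases i) auto
        then show "alt (Suc i) (f (merge G (Suc i) (?h # xs))) = - alt i (f (?h # merge G i xs))"
          by (simp add: alt_def merge_Cons)
      qed
      also have "\<dots> = - (\<Sum>i=1..n. alt i (F (merge G i xs) h))"
        using mt h by (simp add: sum_negf F_def)
      also have "f ((?h \<otimes> g) # ys) = linf_action G g (F ys) h"
        using h xs by (simp add: linf_action_def F_def inv_mult_group)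
      also have "alt (Suc (Suc n)) (f (?h # butlast xs)) = - alt (Suc n) (F (butlast xs) h)"
        using bt h by (simp add: F_def alt_def)
      finally have "f xs = linf_action G g (F ys) h + (\<Sum>i=1..n. alt i (F (merge G i xs) h))
          + alt (Suc n) (F (butlast xs) h)"
        by (simp add: algebra_simps)
      then show ?thesis using True xs(1)
        by (simp add: coboundary_def const_fun_def sum_app alt_app)
    qed
  qed
  ultimately show ?thesis unfolding coboundaries_def by (simp only: nat.case) (rule image_eqI[OF sym])
qed

text \<open>The class of \<open>f\<close> lies in the kernel of \<open>iota_map\<close> by the
  preceding lemma, and \<open>unbounded\<close> keeps it out of the image of
  \<open>comparison_map\<close>.\<close>

lemma not_exact_of_weakly_bounded:
  fixes f :: "'a list \<Rightarrow> 'r::linordered_idom"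
  assumes f: "f \<in> cochains G UNIV (Suc n)" and df: "coboundary G trivial_action (Suc n) f = 0"
    and bound: "\<And>xs. xs \<in> tuples G n \<Longrightarrow> \<exists>c. \<forall>g\<in>carrier G. \<bar>f (g # xs)\<bar> \<le> c"
    and unbounded: "\<And>\<beta> \<gamma> c. \<gamma> \<in> cochains G UNIV n \<Longrightarrow> f = \<beta> + coboundary G trivial_action n \<gamma> \<Longrightarrow>
      (\<And>xs. xs \<in> tuples G (Suc n) \<Longrightarrow> \<bar>\<beta> xs\<bar> \<le> c) \<Longrightarrow> False"
  shows "\<not> exact_at (bounded_cohomology G (Suc n) :: ('a list \<Rightarrow> 'r) set monoid) (comparison_map G (Suc n))
    (group_cohomology G (Suc n) :: ('a list \<Rightarrow> 'r) set monoid) (iota_map G (Suc n))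
    (linf_cohomology G (Suc n) :: ('a list \<Rightarrow> 'a \<Rightarrow> 'r) set monoid)"
proof
  let ?C = "cochains G (UNIV :: 'r set)" and ?d = "coboundary G trivial_action :: nat \<Rightarrow> ('a list \<Rightarrow> 'r) \<Rightarrow> _"
    and ?b = "bounded_cochains G :: nat \<Rightarrow> ('a list \<Rightarrow> 'r) set"
    and ?L = "cochains G (linf G :: ('a \<Rightarrow> 'r) set)"
    and ?dL = "coboundary G (linf_action G) :: nat \<Rightarrow> ('a list \<Rightarrow> 'a \<Rightarrow> 'r) \<Rightarrow> _"
  interpret C: cochain_complex ?C ?d by (rule cochain_complex_trivial)
  interpret L: cochain_complex ?L ?dL by (rule cochain_complex_linf)
  interpret b: cochain_complex ?b ?d by (rule cochain_complex_bounded)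
  assume exact: "exact_at (bounded_cohomology G (Suc n) :: ('a list \<Rightarrow> 'r) set monoid) (comparison_map G (Suc n))
    (group_cohomology G (Suc n) :: ('a list \<Rightarrow> 'r) set monoid) (iota_map G (Suc n))
    (linf_cohomology G (Suc n) :: ('a list \<Rightarrow> 'a \<Rightarrow> 'r) set monoid)"
  define X where "X = coboundaries ?C ?d (Suc n) #>\<^bsub>cocycle_group ?C ?d (Suc n)\<^esub> f"
  have fZ: "f \<in> carrier (cocycle_group ?C ?d (Suc n))" using f df by (simp add: cocycle_group_def)
  have fX: "f \<in> X" unfolding X_def by (rule C.cocycle_mem_class[OF fZ])
  have X: "X \<in> carrier (group_cohomology G (Suc n))"
    using fZ by (simp add: group_cohomology_def C.carrier_cohomology X_def)
  let ?k = "\<lambda>xs. const_fun G (f xs)"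
  have kB: "?k \<in> coboundaries ?L ?dL (Suc n)"
    by (rule const_coboundary_of_weakly_bounded[OF f df bound])
  then have "?k \<in> carrier (cocycle_group ?L ?dL (Suc n))"
    using subgroup.subset[OF normal_imp_subgroup[OF L.coboundaries_normal]] by blast
  \<comment> \<open>\<open>iota_map\<close> is a union over the members of \<open>X\<close>. Once
    that union is known to be a coset, its element \<open>?k\<close> shows which one.\<close>
  from L.cocycle_mem_class[OF this] have "?k \<in> iota_map G (Suc n) X"
    using fX by (auto simp: iota_map_def cohomology_map_def)
  moreover have "iota_map G (Suc n) X \<in> carrier (cohomology ?L ?dL (Suc n))"
    using hom_in_carrier[OF iota_map_hom X] by (simp add: linf_cohomology_def)
  ultimately have "iota_map G (Suc n) X = coboundaries ?L ?dL (Suc n)"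
    using L.coset_eq_coboundaries kB by blast
  then have "X \<in> kernel (group_cohomology G (Suc n)) (linf_cohomology G (Suc n)) (iota_map G (Suc n))"
    using X by (simp add: kernel_def linf_cohomology_def cohomology_def FactGroup_def)
  then obtain Y where Y: "Y \<in> carrier (bounded_cohomology G (Suc n))" "X = comparison_map G (Suc n) Y"
    using exact unfolding exact_at_def by blast
  then obtain \<beta> where \<beta>: "\<beta> \<in> carrier (cocycle_group ?b ?d (Suc n))"
    "Y = coboundaries ?b ?d (Suc n) #>\<^bsub>cocycle_group ?b ?d (Suc n)\<^esub> \<beta>"
    by (auto simp: bounded_cohomology_def b.carrier_cohomology)
  then have "\<beta> \<in> Y" using b.cocycle_mem_class by blast
  moreover have \<beta>Z: "\<beta> \<in> carrier (cocycle_group ?C ?d (Suc n))"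
    using \<beta>(1) by (simp add: cocycle_group_def bounded_cochains_def)
  ultimately have "\<beta> \<in> X"
    using C.cocycle_mem_class[OF \<beta>Z] Y(2) by (auto simp: comparison_map_def cohomology_map_def)
  then obtain \<gamma> where \<gamma>: "\<gamma> \<in> ?C n" "\<beta> = ?d n \<gamma> + f"
    by (auto simp: X_def r_coset_def coboundaries_def cocycle_group_def)
  obtain c where "\<And>xs. xs \<in> tuples G (Suc n) \<Longrightarrow> \<bar>\<beta> xs\<bar> \<le> c"
    using \<beta>(1) by (auto simp: cocycle_group_def bounded_cochains_def)
  moreover have "f = \<beta> + ?d n (- \<gamma>)" using \<gamma> by (simp add: C.d_minus)
  ultimately show False using unbounded[OF C.minus_mem[OF \<gamma>(1)]] by blast
qed

end

section \<open>Presentations\<close>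

definition eval_word :: "('h, 'k) monoid_scheme \<Rightarrow> ('s \<Rightarrow> 'h) \<Rightarrow> ('s \<times> bool) list \<Rightarrow> 'h" where
  "eval_word H f w = foldr (\<lambda>(s, b) x. (if b then f s else inv\<^bsub>H\<^esub> (f s)) \<otimes>\<^bsub>H\<^esub> x) w \<one>\<^bsub>H\<^esub>"

lemma eval_word_simps [simp]:
  "eval_word H f [] = \<one>\<^bsub>H\<^esub>"
  "eval_word H f ((s, b) # w) = (if b then f s else inv\<^bsub>H\<^esub> (f s)) \<otimes>\<^bsub>H\<^esub> eval_word H f w"
  by (simp_all add: eval_word_def)

context
  fixes H :: "('h, 'k) monoid_scheme" and f :: "'s \<Rightarrow> 'h"
  assumes H: "group H" and f: "\<And>s. f s \<in> carrier H"
begin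

interpretation H: group H by (rule H)

lemma eval_word_closed: "eval_word H f w \<in> carrier H"
  by (induction w) (auto simp: f)

lemma eval_word_append: "eval_word H f (u @ v) = eval_word H f u \<otimes>\<^bsub>H\<^esub> eval_word H f v"
  by (induction u) (auto simp: f eval_word_closed H.m_assoc)

lemma eval_word_cancels: "cancels u v \<Longrightarrow> eval_word H f u = eval_word H f v"
proof (induction rule: cancels.induct)
  case (1 u s b v)
  have "x \<otimes>\<^bsub>H\<^esub> (inv\<^bsub>H\<^esub> x \<otimes>\<^bsub>H\<^esub> y) = y" "inv\<^bsub>H\<^esub> x \<otimes>\<^bsub>H\<^esub> (x \<otimes>\<^bsub>H\<^esub> y) = y"
    if "x \<in> carrier H" "y \<in> carrier H" for x y
    using that by (simp_all add: H.m_assoc[symmetric])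
  then show ?case by (simp add: eval_word_append f eval_word_closed)
qed

lemma eval_word_equivclp: "equivclp cancels u v \<Longrightarrow> eval_word H f u = eval_word H f v"
  by (induction rule: equivclp_induct) (auto dest: eval_word_cancels)

end

section \<open>Groups given by generators and relators\<close>

definition presented_group :: "'s set \<Rightarrow> ('s \<times> bool) list set \<Rightarrow> ('s \<times> bool) list set set monoid" where
  "presented_group S R = free_group S Mod normal_closure (free_group S) ((\<lambda>w. free_rel S `` {w}) ` R)"

definition word_class :: "'s set \<Rightarrow> ('s \<times> bool) list set \<Rightarrow> ('s \<times> bool) list \<Rightarrow> ('s \<times> bool) list set set" where
  "word_class S R w = normal_closure (free_group S) ((\<lambda>w. free_rel S `` {w}) ` R) #>\<^bsub>free_group S\<^esub> (free_rel S `` {w})"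

lemma carrier_free_group: "carrier (free_group S) = (\<lambda>w. free_rel S `` {w}) ` words S"
  by (auto simp: free_group_def quotient_def)

context
  fixes S :: "'s set" and R :: "('s \<times> bool) list set"
  assumes R: "R \<subseteq> words S"
begin

interpretation F: group "free_group S" by (rule group_free_group)

interpretation N: normal "normal_closure (free_group S) ((\<lambda>w. free_rel S `` {w}) ` R)" "free_group S"
  by (rule normal_closure_normal[OF group_free_group]) (use R in \<open>auto simp: carrier_free_group\<close>)

lemma group_presented_group: "group (presented_group S R)"
  unfolding presented_group_def by (rule N.factorgroup_is_group)

lemma carrier_presented_group: "carrier (presented_group S R) = word_class S R ` words S"
  by (auto simp: presented_group_def carrier_FactGroup carrier_free_group word_class_def)

lemma word_class_append:
  assumes "u \<in> words S" "v \<in> words S"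
  shows "word_class S R (u @ v) = word_class S R u \<otimes>\<^bsub>presented_group S R\<^esub> word_class S R v"
  using assms by (simp add: presented_group_def word_class_def N.rcos_sum carrier_free_group free_group_mult)

lemma word_class_Nil: "word_class S R [] = \<one>\<^bsub>presented_group S R\<^esub>"
proof -
  have "free_rel S `` {[]} = \<one>\<^bsub>free_group S\<^esub>" by (simp add: free_group_def)
  then show ?thesis
    using F.coset_mult_one[OF N.subset] by (simp add: word_class_def presented_group_def)
qed

lemma word_class_relator:
  assumes "r \<in> R"
  shows "word_class S R r = \<one>\<^bsub>presented_group S R\<^esub>"
proof -
  have r: "free_rel S `` {r} \<in> normal_closure (free_group S) ((\<lambda>w. free_rel S `` {w}) ` R)"
    using assms by (auto simp: normal_closure_def)
  show ?thesis
    using F.coset_join2[OF _ N.subgroup_axioms r] subsetD[OF N.subset r] by (auto simp: word_class_def presented_group_def)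
qed

lemma word_class_equivclp:
  assumes "u \<in> words S" "v \<in> words S" "equivclp cancels u v"
  shows "word_class S R u = word_class S R v"
proof -
  have "free_rel S `` {u} = free_rel S `` {v}"
    by (rule equiv_class_eq[OF equiv_free_rel]) (use assms in \<open>auto simp: free_rel_def\<close>)
  then show ?thesis by (simp add: word_class_def)
qed

lemma word_class_inv_letter:
  assumes "s \<in> S"
  shows "word_class S R [(s, False)] = inv\<^bsub>presented_group S R\<^esub> (word_class S R [(s, True)])"
proof -
  interpret P: group "presented_group S R" by (rule group_presented_group)
  have w: "[(s, b)] \<in> words S" "[(s, False), (s, True)] \<in> words S" for b
    using assms by (auto simp: words_def)
  have "cancels ([] @ (s, False) # (s, \<not> False) # []) ([] @ [])" by (rule cancels.intros)
  then have "equivclp cancels [(s, False), (s, True)] []" by auto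
  then have "word_class S R [(s, False)] \<otimes>\<^bsub>presented_group S R\<^esub> word_class S R [(s, True)]
      = \<one>\<^bsub>presented_group S R\<^esub>"
    using word_class_equivclp[OF w(2) words_Nil] word_class_append[OF w(1) w(1), of False True]
    by (simp add: word_class_Nil)
  then show ?thesis
    by (intro P.inv_equality[symmetric]) (use w in \<open>auto simp: carrier_presented_group\<close>)
qed

lemma eval_word_word_class:
  assumes "w \<in> words S"
  shows "eval_word (presented_group S R) (\<lambda>s. word_class S R [(s, True)]) w = word_class S R w"
  using assms
proof (induction w)
  case Nil
  then show ?case by (simp add: word_class_Nil)
next
  case (Cons l w)
  obtain s b where l: "l = (s, b)" by (cases l)
  with Cons.prems have s: "s \<in> S" "w \<in> words S" "[(s, b)] \<in> words S" by (auto simp: words_def)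
  then show ?case
    using Cons.IH word_class_append[OF s(3,2)] by (cases b) (simp_all add: l word_class_inv_letter)
qed

text \<open>The classes on which the evaluation is trivial form a normal subgroup containing the
  relators. It is described by representatives, as no homomorphism on classes has been constructed
  yet.\<close>

lemma normal_closure_eval:
  assumes H: "group H" and f: "\<And>s. f s \<in> carrier H" and rel: "\<And>r. r \<in> R \<Longrightarrow> eval_word H f r = \<one>\<^bsub>H\<^esub>"
    and "X \<in> normal_closure (free_group S) ((\<lambda>w. free_rel S `` {w}) ` R)" "w \<in> X"
  shows "eval_word H f w = \<one>\<^bsub>H\<^esub>"
proof -
  interpret H: group H by (rule H)
  note eval = eval_word_closed[OF H f] eval_word_append[OF H f]
  define K where "K = {X \<in> carrier (free_group S). \<forall>w\<in>X. eval_word H f w = \<one>\<^bsub>H\<^esub>}"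
  have self: "w \<in> free_rel S `` {w}" if "w \<in> words S" for w
    using that equiv_free_rel by (metis equiv_class_self)
  \<comment> \<open>Evaluation respects \<open>cancels\<close>, so one representative decides
    membership.\<close>
  have K: "free_rel S `` {w} \<in> K \<longleftrightarrow> eval_word H f w = \<one>\<^bsub>H\<^esub>" if "w \<in> words S" for w
    using that self[OF that] eval_word_equivclp[OF H f]
    by (force simp: K_def carrier_free_group free_rel_def)
  have K_sub: "K \<subseteq> carrier (free_group S)" by (auto simp: K_def)
  have mult: "u \<in> words S \<Longrightarrow> v \<in> words S \<Longrightarrow> free_rel S `` {u} \<in> K \<Longrightarrow> free_rel S `` {v} \<in> K \<Longrightarrow>
      free_rel S `` {u @ v} \<in> K" for u v
    by (simp add: K words_append eval)
  \<comment> \<open>The formal inverse \<open>word_inv u\<close> represents the inverse class and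
    evaluates to the inverse.\<close>
  have inv_ex: "\<exists>v\<in>words S. inv\<^bsub>free_group S\<^esub> (free_rel S `` {u}) = free_rel S `` {v} \<and>
      eval_word H f v = inv\<^bsub>H\<^esub> (eval_word H f u)" if u: "u \<in> words S" for u
  proof -
    have w: "word_inv u \<in> words S" using u by (auto simp: words_def word_inv_def)
    have "eval_word H f (word_inv u) \<otimes>\<^bsub>H\<^esub> eval_word H f u = \<one>\<^bsub>H\<^esub>"
      using eval_word_equivclp[OF H f word_inv_cancels[of u]] by (simp add: eval)
    moreover have "free_rel S `` {word_inv u @ u} = free_rel S `` {[]}"
      by (rule equiv_class_eq[OF equiv_free_rel])
        (use u w in \<open>auto simp: free_rel_def words_append words_Nil word_inv_cancels\<close>)
    then have "free_rel S `` {word_inv u} \<otimes>\<^bsub>free_group S\<^esub> free_rel S `` {u} = \<one>\<^bsub>free_group S\<^esub>"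
      using u w by (simp add: free_group_mult) (simp add: free_group_def)
    ultimately show ?thesis
      using u w H.inv_equality F.inv_equality
      by (intro bexI[of _ "word_inv u"]) (auto simp: eval carrier_free_group)
  qed
  have "subgroup K (free_group S)"
  proof (rule F.subgroupI[OF K_sub])
    show "K \<noteq> {}" using K[OF words_Nil] by auto
    show "inv\<^bsub>free_group S\<^esub> X \<in> K" if X: "X \<in> K" for X
    proof -
      obtain u where u: "u \<in> words S" "X = free_rel S `` {u}"
        using subsetD[OF K_sub X] by (auto simp: carrier_free_group)
      then show ?thesis using inv_ex[OF u(1)] X K by auto
    qed
    show "X \<otimes>\<^bsub>free_group S\<^esub> Y \<in> K" if XY: "X \<in> K" "Y \<in> K" for X Y
    proof -
      obtain u v where uv: "u \<in> words S" "X = free_rel S `` {u}" "v \<in> words S" "Y = free_rel S `` {v}"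
        using XY[THEN subsetD[OF K_sub]] by (auto simp: carrier_free_group)
      show ?thesis
        using mult[OF uv(1,3)] XY unfolding uv(2,4) free_group_mult[OF uv(1,3)] by blast
    qed
  qed
  then have "K \<lhd> free_group S"
  proof (rule F.normal_invI)
    fix X Y assume X: "X \<in> K" and Y: "Y \<in> carrier (free_group S)"
    obtain u v where u: "u \<in> words S" "X = free_rel S `` {u}" and v: "v \<in> words S" "Y = free_rel S `` {v}"
      using subsetD[OF K_sub X] Y by (auto simp: carrier_free_group)
    obtain w where w: "w \<in> words S" "inv\<^bsub>free_group S\<^esub> Y = free_rel S `` {w}"
      "eval_word H f w = inv\<^bsub>H\<^esub> (eval_word H f v)" using inv_ex[OF v(1)] v(2) by auto
    have "eval_word H f ((v @ u) @ w) = \<one>\<^bsub>H\<^esub>"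
      using K[OF u(1)] X u(2) w(3) by (simp add: eval)
    then show "Y \<otimes>\<^bsub>free_group S\<^esub> X \<otimes>\<^bsub>free_group S\<^esub> inv\<^bsub>free_group S\<^esub> Y \<in> K"
      using u v w by (simp add: free_group_mult words_append K)
  qed
  moreover have "(\<lambda>w. free_rel S `` {w}) ` R \<subseteq> K" using R rel K by auto
  ultimately have "X \<in> K" using assms(4) by (auto simp: normal_closure_def)
  then show ?thesis using assms(5) by (simp add: K_def)
qed

text \<open>Von Dyck's theorem. It is used to map the group to \<open>sl2\<close> and to the
  integers.\<close>

lemma presented_group_hom:
  assumes H: "group H" and f: "\<And>s. f s \<in> carrier H" and rel: "\<And>r. r \<in> R \<Longrightarrow> eval_word H f r = \<one>\<^bsub>H\<^esub>"
  obtains \<rho> where "\<rho> \<in> hom (presented_group S R) H" "\<And>w. w \<in> words S \<Longrightarrow> \<rho> (word_class S R w) = eval_word H f w"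
proof
  interpret H: group H by (rule H)
  note eval = eval_word_closed[OF H f] eval_word_append[OF H f]
  \<comment> \<open>An element \<open>X\<close> is a set of classes of words, so
    \<open>\<Union>X\<close> consists of all words that represent it; the evaluation is constant
    there.\<close>
  let ?\<rho> = "\<lambda>X. the_elem (eval_word H f ` \<Union>X)"
  have self: "w \<in> free_rel S `` {w}" if "w \<in> words S" for w
    using that equiv_free_rel by (metis equiv_class_self)
  show \<rho>: "?\<rho> (word_class S R w) = eval_word H f w" if w: "w \<in> words S" for w
  proof -
    have "eval_word H f v = eval_word H f w" if "X \<in> word_class S R w" "v \<in> X" for v X
    proof -
      obtain Y where Y: "Y \<in> normal_closure (free_group S) ((\<lambda>w. free_rel S `` {w}) ` R)"
        "X = Y \<otimes>\<^bsub>free_group S\<^esub> free_rel S `` {w}"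
        using \<open>X \<in> _\<close> by (auto simp: word_class_def r_coset_def)
      then obtain y where y: "y \<in> words S" "Y = free_rel S `` {y}"
        using N.subset by (auto simp: carrier_free_group)
      have "equivclp cancels (y @ w) v"
        using \<open>v \<in> X\<close> unfolding Y(2) y(2) free_group_mult[OF y(1) w] by (simp only: free_rel_def) blast
      then have "eval_word H f v = eval_word H f y \<otimes>\<^bsub>H\<^esub> eval_word H f w"
        using eval_word_equivclp[OF H f, of "y @ w" v] by (simp only: eval(2))
      moreover have "eval_word H f y = \<one>\<^bsub>H\<^esub>"
        using normal_closure_eval[OF H f rel Y(1)] self[OF y(1)] y(2) by auto
      ultimately show ?thesis by (simp add: eval)
    qed
    moreover have "free_rel S `` {w} \<in> word_class S R w"
      unfolding word_class_def
      by (rule F.rcos_self[OF _ N.subgroup_axioms]) (use w in \<open>auto simp: carrier_free_group\<close>)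
    ultimately have "eval_word H f ` \<Union>(word_class S R w) = {eval_word H f w}"
      using self[OF w] by blast
    then show ?thesis by simp
  qed
  show "?\<rho> \<in> hom (presented_group S R) H"
    by (rule homI) (auto simp: carrier_presented_group \<rho> eval word_class_append[symmetric] words_append)
qed

text \<open>Commuting with a generator entails commuting with its inverse, and then with every word
  by induction.\<close>

lemma presented_group_central:
  assumes t: "t \<in> carrier (presented_group S R)"
    and comm: "\<And>s. s \<in> S \<Longrightarrow> t \<otimes>\<^bsub>presented_group S R\<^esub> word_class S R [(s, True)]
      = word_class S R [(s, True)] \<otimes>\<^bsub>presented_group S R\<^esub> t"
    and g: "g \<in> carrier (presented_group S R)"
  shows "t \<otimes>\<^bsub>presented_group S R\<^esub> g = g \<otimes>\<^bsub>presented_group S R\<^esub> t"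
proof -
  interpret P: group "presented_group S R" by (rule group_presented_group)
  have "t \<otimes>\<^bsub>presented_group S R\<^esub> word_class S R w = word_class S R w \<otimes>\<^bsub>presented_group S R\<^esub> t"
    if "w \<in> words S" for w
    using that
  proof (induction w)
    case Nil
    show ?case using t by (simp add: word_class_Nil)
  next
    case (Cons l w)
    obtain s b where l: "l = (s, b)" by (cases l)
    with Cons.prems have s: "s \<in> S" and w: "w \<in> words S" and sb: "[(s, b')] \<in> words S" for b'
      by (auto simp: words_def)
    let ?x = "word_class S R [(s, True)]" and ?y = "word_class S R [(s, b)]"
    have car: "word_class S R w \<in> carrier (presented_group S R)" "?x \<in> carrier (presented_group S R)"
        "?y \<in> carrier (presented_group S R)"
      using w sb by (auto simp: carrier_presented_group)
    have "t \<otimes>\<^bsub>presented_group S R\<^esub> ?y = ?y \<otimes>\<^bsub>presented_group S R\<^esub> t"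
    proof (cases b)
      case False
      have "?x \<otimes>\<^bsub>presented_group S R\<^esub> (t \<otimes>\<^bsub>presented_group S R\<^esub> inv\<^bsub>presented_group S R\<^esub> ?x)
          = (t \<otimes>\<^bsub>presented_group S R\<^esub> ?x) \<otimes>\<^bsub>presented_group S R\<^esub> inv\<^bsub>presented_group S R\<^esub> ?x"
        using t car by (simp add: comm[OF s] P.m_assoc)
      also have "\<dots> = t" using t car by (simp add: P.m_assoc)
      finally show ?thesis
        using False t car by (simp add: word_class_inv_letter[OF s] P.inv_solve_left)
    qed (simp add: comm[OF s])
    moreover have "word_class S R (l # w) = ?y \<otimes>\<^bsub>presented_group S R\<^esub> word_class S R w"
      using word_class_append[OF sb w] by (simp add: l)
    ultimately show ?case
      using Cons.IH[OF w] t car P.m_assoc by metis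
  qed
  then show ?thesis using g by (auto simp: carrier_presented_group)
qed

end

text \<open>The elements of the presented group are sets of sets of words. There are only countably
  many, so the structure can be transported to a set of natural numbers.\<close>

lemma finitely_presented_nat_copy:
  fixes S :: "nat set"
  assumes "finite S" "finite R" and R: "R \<subseteq> words S"
  obtains G :: "nat monoid" and \<phi> where "finitely_presented G" "\<phi> \<in> iso (presented_group S R) G"
proof -
  let ?P = "presented_group S R"
  interpret P: group ?P by (rule group_presented_group[OF R])
  have "countable (carrier ?P)" by (simp add: carrier_presented_group[OF R])
  then have inj: "inj_on (to_nat_on (carrier ?P)) (carrier ?P)" by (rule inj_on_to_nat_on)
  define \<phi> where "\<phi> = to_nat_on (carrier ?P)"
  define \<psi> where "\<psi> = inv_into (carrier ?P) \<phi>"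
  have \<psi>: "\<psi> (\<phi> x) = x" if "x \<in> carrier ?P" for x
    using inj that by (simp add: \<psi>_def \<phi>_def)
  define G where "G = \<lparr>carrier = \<phi> ` carrier ?P, monoid.mult = (\<lambda>x y. \<phi> (\<psi> x \<otimes>\<^bsub>?P\<^esub> \<psi> y)), one = \<phi> \<one>\<^bsub>?P\<^esub>\<rparr>"
  have iso: "\<phi> \<in> iso ?P G"
    using inj by (auto simp: iso_def hom_def bij_betw_def G_def \<psi> \<phi>_def[symmetric])
  have "monoid G"
    by (rule monoidI) (auto simp: G_def \<psi> P.m_assoc)
  then have "group G" using P.iso_imp_group iso by (auto simp: is_iso_def)
  moreover have "G \<cong> ?P" using P.iso_sym iso by (auto simp: is_iso_def)
  moreover have "(\<lambda>w. free_rel S `` {w}) ` R \<subseteq> carrier (free_group S)"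
    using R by (auto simp: carrier_free_group)
  ultimately have "finitely_presented G"
    using assms unfolding finitely_presented_def presented_group_def by blast
  then show ?thesis using iso that by blast
qed

section \<open>Classes detected on products with tori\<close>

primrec iterated_cup ::
    "('a, 'k) monoid_scheme \<Rightarrow> nat \<Rightarrow> ('a list \<Rightarrow> 'r::comm_ring_1) \<Rightarrow> (nat \<Rightarrow> 'a \<Rightarrow> int) \<Rightarrow> nat \<Rightarrow> 'a list \<Rightarrow> 'r" where
  "iterated_cup G n f t 0 = f"
| "iterated_cup G n f t (Suc j) = cup_hom G (n + j) (iterated_cup G n f t j) (t j)"

text \<open>The relations make \<open>4([a|b] - [cb|a] - [c|b]) + [c|c] + [c|c\<^sup>2] + [c|c\<^sup>3] + [1|1]\<close> a 2-cycle, on which \<open>B\<close>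
  takes the value \<open>-4\<close>.\<close>

locale detected_cocycle = group G for G (structure) +
  fixes B :: "'a \<Rightarrow> 'a \<Rightarrow> int" and t :: "nat \<Rightarrow> 'a \<Rightarrow> int" and m :: nat and a b c :: 'a
  assumes B_cocycle: "\<And>g h k. g \<in> carrier G \<Longrightarrow> h \<in> carrier G \<Longrightarrow> k \<in> carrier G \<Longrightarrow>
      B h k - B (g \<otimes> h) k + B g (h \<otimes> k) - B g h = 0"
    and B_bound: "\<And>g h. \<bar>B g h\<bar> \<le> 1"
    and t_mult: "\<And>j g h. g \<in> carrier G \<Longrightarrow> h \<in> carrier G \<Longrightarrow> t j (g \<otimes> h) = t j g + t j h"
    and central: "\<And>j k. j < m \<Longrightarrow> \<exists>s\<in>carrier G. (\<forall>g\<in>carrier G. s \<otimes> g = g \<otimes> s \<and> B s g = 0 \<and> B g s = 0) \<and>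
      (\<forall>i<m. t i s = (if i = j then int k else 0))"
    and abc: "a \<in> carrier G" "b \<in> carrier G" "c \<in> carrier G"
    and rel: "c \<otimes> b \<otimes> a = a \<otimes> b" "c \<otimes> (c \<otimes> (c \<otimes> c)) = \<one>"
    and B_values: "B a b = 0" "B (c \<otimes> b) a = 0" "B c b = 1" "B c c = 0" "B c (c \<otimes> c) = 0"
      "B c (c \<otimes> (c \<otimes> c)) = 0" "B \<one> \<one> = 0"
begin

section \<open>The cup products of \<open>base\<close> with the homomorphisms\<close>

definition base :: "'a list \<Rightarrow> 'r::linordered_idom" where
  "base xs = (if xs \<in> tuples G 2 then of_int (B (xs ! 0) (xs ! 1)) else 0)"

abbreviation cup :: "nat \<Rightarrow> 'a list \<Rightarrow> 'r::linordered_idom" where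
  "cup \<equiv> iterated_cup G 2 base t"

lemma cup_mem: "cup j \<in> cochains G UNIV (2 + j)"
proof (cases j)
  case 0
  then show ?thesis by (simp add: cochains_def base_def)
next
  case (Suc i)
  then show ?thesis using cup_hom_mem[of "2 + i"] by simp
qed

lemma coboundary_cup:
  "coboundary G trivial_action (2 + j) (cup j :: 'a list \<Rightarrow> 'r::linordered_idom) = 0"
proof (induction j)
  case 0
  show ?case
  proof
    fix xs
    have two: "{Suc 0..2} = {1, 2}" by auto
    show "coboundary G trivial_action (2 + 0) (cup 0 :: _ \<Rightarrow> 'r) xs = 0 xs"
    proof (cases "xs \<in> tuples G 3")
      case True
      then obtain g h k where "xs = [g, h, k]" "g \<in> carrier G" "h \<in> carrier G" "k \<in> carrier G"
        by (auto simp: tuples_def length_Suc_conv numeral_3_eq_3)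
      moreover from this have "of_int (B h k - B (g \<otimes> h) k + B g (h \<otimes> k) - B g h) = (0 :: 'r)"
        by (simp only: B_cocycle of_int_0)
      ultimately show ?thesis
        by (simp add: coboundary_def trivial_action_def base_def alt_def merge_def tuples_def two)
    qed (simp add: coboundary_def numeral_2_eq_2 numeral_3_eq_3)
  qed
next
  case (Suc j)
  have "coboundary G trivial_action (Suc (2 + j)) (cup_hom G (2 + j) (cup j :: _ \<Rightarrow> 'r) (t j)) = 0"
    by (rule cup_hom_cocycle[OF cup_mem Suc t_mult])
  then show ?case by (simp only: iterated_cup.simps add_Suc_right)
qed

text \<open>Each new factor depends only on the last argument, which is among the fixed ones; the
  varying first argument enters only \<open>B\<close>.\<close>

lemma cup_weakly_bounded:
  assumes "xs \<in> tuples G (Suc j)"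
  shows "\<exists>C. \<forall>g\<in>carrier G. \<bar>cup j (g # xs) :: 'r::linordered_idom\<bar> \<le> C"
  using assms
proof (induction j arbitrary: xs)
  case 0
  have "\<bar>of_int (B g h) :: 'r\<bar> \<le> 1" for g h
    using B_bound[of g h] by (metis of_int_abs of_int_le_1_iff)
  then show ?case by (auto simp: base_def intro!: exI[of _ 1])
next
  case (Suc j)
  then have "xs \<noteq> []" "butlast xs \<in> tuples G (Suc j)"
    by (auto simp: tuples_def dest: in_set_butlastD)
  with Suc.IH[of "butlast xs"] obtain C where
    C: "\<And>g. g \<in> carrier G \<Longrightarrow> \<bar>cup j (g # butlast xs) :: 'r\<bar> \<le> C" by blast
  have "\<bar>cup (Suc j) (g # xs) :: 'r\<bar> \<le> C * \<bar>of_int (t j (last xs))\<bar>" if "g \<in> carrier G" for g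
    using \<open>xs \<noteq> []\<close> C[OF that] order_trans[OF abs_ge_zero C[OF that]]
    by (auto simp: cup_hom_def abs_mult intro!: mult_right_mono)
  then show ?case by blast
qed

text \<open>Every entry of \<open>xs\<close> is an argument of \<open>B\<close> or of one of the
  \<open>t i\<close>, and each of these factors vanishes when \<open>s\<close> is an
  argument.\<close>

lemma cup_vanishes:
  assumes "\<And>g. g \<in> carrier G \<Longrightarrow> B s g = 0 \<and> B g s = 0" "\<And>i. i < j \<Longrightarrow> t i s = 0" "s \<in> set xs"
  shows "cup j xs = 0"
  using assms(2,3)
proof (induction j arbitrary: xs)
  case 0
  show ?case
  proof (cases "xs \<in> tuples G 2")
    case True
    then obtain g h where "xs = [g, h]" "g \<in> carrier G" "h \<in> carrier G"
      by (auto simp: tuples_def length_Suc_conv numeral_2_eq_2)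
    then show ?thesis using 0(2) assms(1) by (auto simp: base_def)
  qed (simp add: base_def)
next
  case (Suc j)
  have "xs = butlast xs @ [last xs]" using Suc.prems(2) by (cases xs) auto
  with Suc.prems(2) have "s \<in> set (butlast xs) \<or> s = last xs"
    by (metis Un_iff empty_iff empty_set set_ConsD set_append)
  then show ?case using Suc by (auto simp: cup_hom_def)
qed

text \<open>The class of \<open>cup j\<close>, multiplied by \<open>k\<close>, has a representative
  of sup norm at most \<open>C\<close>. The bound is a separate parameter so that its independence
  of \<open>k\<close> can be expressed.\<close>

definition bounded_mod_coboundary :: "nat \<Rightarrow> 'r::linordered_idom \<Rightarrow> int \<Rightarrow> bool" where
  "bounded_mod_coboundary j C k \<longleftrightarrow> (\<exists>\<beta> \<gamma>. \<gamma> \<in> cochains G UNIV (Suc j) \<and>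
     (\<forall>xs. of_int k * cup j xs = \<beta> xs + coboundary G trivial_action (Suc j) \<gamma> xs) \<and>
     (\<forall>xs\<in>tuples G (2 + j). \<bar>\<beta> xs\<bar> \<le> C))"

lemma bounded_mod_coboundary_uminus:
  assumes "bounded_mod_coboundary j (C :: 'r::linordered_idom) k"
  shows "bounded_mod_coboundary j C (- k)"
proof -
  interpret Z: cochain_complex "cochains G (UNIV :: 'r set)" "coboundary G trivial_action"
    by (rule cochain_complex_trivial)
  obtain \<beta> \<gamma> where "\<gamma> \<in> cochains G UNIV (Suc j)"
    "\<And>xs. of_int k * cup j xs = \<beta> xs + coboundary G trivial_action (Suc j) \<gamma> xs"
    "\<And>xs. xs \<in> tuples G (2 + j) \<Longrightarrow> \<bar>\<beta> xs\<bar> \<le> C"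
    using assms unfolding bounded_mod_coboundary_def by blast
  then show ?thesis
    unfolding bounded_mod_coboundary_def
    by (intro exI[of _ "- \<beta>"] exI[of _ "- \<gamma>"]) (simp add: Z.minus_mem Z.d_minus)
qed

text \<open>Contraction with a central \<open>s\<close> such that \<open>t j s = k\<close> turns
  \<open>cup (Suc j)\<close> into \<open>k\<close> times \<open>cup j\<close> up to sign and
  preserves coboundaries. The factor \<open>j + 3\<close> is the number of insertion places.\<close>

lemma bounded_mod_coboundary_contract:
  assumes "bounded_mod_coboundary (Suc j) (C :: 'r::linordered_idom) 1" "j < m"
  shows "bounded_mod_coboundary j (of_nat (j + 3) * C) (int k)"
proof -
  obtain s where s: "s \<in> carrier G" "\<forall>g\<in>carrier G. s \<otimes> g = g \<otimes> s \<and> B s g = 0 \<and> B g s = 0"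
      "\<forall>i<m. t i s = (if i = j then int k else 0)"
    using central[OF assms(2), of k] by (elim bexE conjE)
  then have comm: "\<And>g. g \<in> carrier G \<Longrightarrow> s \<otimes> g = g \<otimes> s" by blast
  obtain \<beta> \<gamma> :: "'a list \<Rightarrow> 'r" where \<gamma>: "\<gamma> \<in> cochains G UNIV (Suc (Suc j))"
    and eq: "\<And>xs. cup (Suc j) xs = \<beta> xs + coboundary G trivial_action (Suc (Suc j)) \<gamma> xs"
    and \<beta>: "\<And>xs. xs \<in> tuples G (Suc (Suc (Suc j))) \<Longrightarrow> \<bar>\<beta> xs\<bar> \<le> C"
    using assms(1) by (auto simp: bounded_mod_coboundary_def)
  let ?i = "contraction G s"
  \<comment> \<open>The \<open>t i\<close> with \<open>i < j\<close> vanish on \<open>s\<close>, as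
    does \<open>B\<close>.\<close>
  have vanish: "cup j xs = (0 :: 'r)" if "s \<in> set xs" for xs
    using that s(2,3) assms(2) by (intro cup_vanishes) auto
  interpret Z: cochain_complex "cochains G (UNIV :: 'r set)" "coboundary G trivial_action"
    by (rule cochain_complex_trivial)
  have eq': "(of_int (alt (2 + j) (int k)) :: 'r) * cup j xs = ?i (2 + j) \<beta> xs
      + coboundary G trivial_action (Suc j) (- ?i (Suc j) \<gamma>) xs" for xs
  proof -
    have "(of_int (alt (2 + j) (int k)) :: 'r) * cup j xs = alt (2 + j) (of_int (t j s)) * cup j xs"
      using s(3) assms(2) by (simp add: alt_def)
    also have "\<dots> = ?i (2 + j) (cup (Suc j)) xs"
      using contraction_cup_hom[OF s(1) cup_mem vanish, of "t j"] by simp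
    also have "\<dots> = ?i (2 + j) \<beta> xs
        + ?i (Suc (Suc j)) (coboundary G trivial_action (Suc (Suc j)) \<gamma>) xs"
      by (simp only: contraction_def eq alt_add sum.distrib) simp
    finally show ?thesis
      by (simp add: contraction_coboundary[OF s(1) comm \<gamma>] Z.d_minus[OF contraction_mem])
  qed
  have "bounded_mod_coboundary j (of_nat (j + 3) * C) (alt (2 + j) (int k))"
    unfolding bounded_mod_coboundary_def
  proof (intro exI conjI allI ballI)
    show "- ?i (Suc j) \<gamma> \<in> cochains G UNIV (Suc j)"
      by (rule cochain_complex.minus_mem[OF cochain_complex_trivial contraction_mem])
    show "\<bar>?i (2 + j) \<beta> xs\<bar> \<le> of_nat (j + 3) * C" if "xs \<in> tuples G (2 + j)" for xs
      using contraction_bound[OF s(1), of "2 + j" \<beta> C xs] \<beta> that by (simp add: eval_nat_numeral)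
  qed (rule eq')
  \<comment> \<open>For odd \<open>j\<close> the multiple is \<open>- k\<close>, and a change of
    sign removes the minus.\<close>
  then show ?thesis
    using bounded_mod_coboundary_uminus[of j "of_nat (j + 3) * C" "- int k"]
    by (auto simp: alt_def split: if_splits)
qed

text \<open>All contractions but the last use \<open>k = 1\<close>. The last one, from degree 3 to
  degree 2, is done for every \<open>k\<close>, with the same bound.\<close>

lemma bounded_mod_coboundary_descend:
  assumes "bounded_mod_coboundary (Suc j) (C :: 'r::linordered_idom) 1" "j < m"
  shows "\<exists>C :: 'r. \<forall>k. bounded_mod_coboundary 0 C (int k)"
  using assms
proof (induction j arbitrary: C)
  case 0
  then show ?case using bounded_mod_coboundary_contract[of 0] by blast
next
  case (Suc j)
  then show ?case
    using bounded_mod_coboundary_contract[OF Suc.prems, of 1] by (metis Suc_lessD of_nat_1)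
qed

text \<open>Pairing with the 2-cycle kills the coboundary. The value of \<open>B\<close> there is
  \<open>-4\<close> and the sum of the absolute values of the coefficients is 16, hence
  \<open>4 k \<le> 16 C\<close>.\<close>

lemma base_detected:
  assumes "bounded_mod_coboundary 0 (C :: 'r::linordered_idom) (int k)"
  shows "of_nat k \<le> 4 * C"
proof -
  obtain \<beta>' \<gamma>' :: "'a list \<Rightarrow> 'r" where
    eq: "\<And>xs. of_int (int k) * base xs = \<beta>' xs + coboundary G trivial_action (Suc 0) \<gamma>' xs"
    and \<beta>': "\<And>xs. xs \<in> tuples G 2 \<Longrightarrow> \<bar>\<beta>' xs\<bar> \<le> C"
    using assms by (auto simp: bounded_mod_coboundary_def)
  define \<beta> where "\<beta> g h = \<beta>' [g, h]" for g h
  define \<gamma> where "\<gamma> g = \<gamma>' [g]" for g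
  have eq: "of_nat k * of_int (B g h) = \<beta> g h + \<gamma> h - \<gamma> (g \<otimes> h) + \<gamma> g"
    if "g \<in> carrier G" "h \<in> carrier G" for g h
    using eq[of "[g, h]"] that
    by (simp add: base_def \<beta>_def \<gamma>_def coboundary_def trivial_action_def alt_def merge_def tuples_def)
  have bd: "\<beta> g h \<le> C" "- \<beta> g h \<le> C" if "g \<in> carrier G" "h \<in> carrier G" for g h
    using \<beta>'[of "[g, h]"] that by (auto simp: \<beta>_def tuples_def abs_le_iff)
  let ?c2 = "c \<otimes> c" and ?c3 = "c \<otimes> (c \<otimes> c)"
  have car: "c \<otimes> b \<in> carrier G" "?c2 \<in> carrier G" "?c3 \<in> carrier G" using abc by auto
  note e = eq[OF abc(1,2)] eq[OF car(1) abc(1)] eq[OF abc(3,2)] eq[OF abc(3,3)] eq[OF abc(3) car(2)]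
    eq[OF abc(3) car(3)] eq[OF one_closed one_closed]
  \<comment> \<open>The relations identify the products under \<open>\<gamma>\<close>, so that all
    values of \<open>\<gamma>\<close> cancel in the combination below.\<close>
  note e = e[unfolded B_values rel r_one[OF one_closed]]
  note d = bd[OF abc(1,2)] bd[OF car(1) abc(1)] bd[OF abc(3,2)] bd[OF abc(3,3)] bd[OF abc(3) car(2)]
    bd[OF abc(3) car(3)] bd[OF one_closed one_closed]
  \<comment> \<open>\<open>4 * X + Y\<close> is the value of \<open>\<beta>\<close> on the negative
    of the cycle; \<open>X\<close> has three terms and \<open>Y\<close> has four.\<close>
  define X where "X = \<beta> (c \<otimes> b) a + \<beta> c b - \<beta> a b"
  define Y where "Y = - (\<beta> c c + \<beta> c ?c2 + \<beta> c ?c3 + \<beta> \<one> \<one>)"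
  have "4 * of_nat k = 4 * X + Y"
    using e unfolding X_def Y_def by (simp add: algebra_simps)
  moreover have "X \<le> C + C + C" "Y \<le> C + C + C + C"
    using d unfolding X_def Y_def by linarith+
  ultimately have "4 * of_nat k \<le> 16 * C"
    using mult_left_mono[of X "3 * C" 4] by simp
  then show ?thesis by simp
qed

text \<open>A bounded representative of \<open>cup m\<close> would bound every natural number by
  \<open>4 * C'\<close>, against the Archimedean property \<open>arch\<close>.\<close>

lemma not_exact:
  assumes "m \<ge> 1" and arch: "\<And>x :: 'r::linordered_idom. \<exists>k. x < of_nat k"
  shows "\<not> exact_at (bounded_cohomology G (2 + m) :: ('a list \<Rightarrow> 'r) set monoid) (comparison_map G (2 + m))
    (group_cohomology G (2 + m) :: ('a list \<Rightarrow> 'r) set monoid) (iota_map G (2 + m))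
    (linf_cohomology G (2 + m) :: ('a list \<Rightarrow> 'a \<Rightarrow> 'r) set monoid)"
proof -
  obtain j where j: "m = Suc j" using assms(1) by (cases m) auto
  have False if "\<gamma> \<in> cochains G UNIV (Suc m)" "cup m = \<beta> + coboundary G trivial_action (Suc m) \<gamma>"
    "\<And>xs. xs \<in> tuples G (Suc (Suc m)) \<Longrightarrow> \<bar>\<beta> xs\<bar> \<le> C" for \<beta> \<gamma> and C :: 'r
  proof -
    have "bounded_mod_coboundary m C 1"
      using that unfolding bounded_mod_coboundary_def
      by (intro exI[of _ \<beta>] exI[of _ \<gamma>]) (simp add: fun_eq_iff)
    then obtain C' :: 'r where "\<And>k. bounded_mod_coboundary 0 C' (int k)"
      using bounded_mod_coboundary_descend[of j C] j by auto
    then have "of_nat k \<le> 4 * C'" for k by (rule base_detected)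
    with arch[of "4 * C'"] show False by (metis not_less)
  qed
  moreover have "cup m \<in> cochains G UNIV (Suc (Suc m))"
    and "coboundary G trivial_action (Suc (Suc m)) (cup m :: _ \<Rightarrow> 'r) = 0"
    using cup_mem[of m] coboundary_cup[of m] by simp_all
  ultimately have "\<not> exact_at (bounded_cohomology G (Suc (Suc m)) :: ('a list \<Rightarrow> 'r) set monoid)
    (comparison_map G (Suc (Suc m))) (group_cohomology G (Suc (Suc m)) :: ('a list \<Rightarrow> 'r) set monoid)
    (iota_map G (Suc (Suc m))) (linf_cohomology G (Suc (Suc m)) :: ('a list \<Rightarrow> 'a \<Rightarrow> 'r) set monoid)"
    using cup_weakly_bounded by (intro not_exact_of_weakly_bounded[of "cup m"]) blast+
  then show ?thesis by simp
qed

end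

section \<open>The orientation cocycle of the projective line\<close>

definition sgn_int :: "real \<Rightarrow> int" where
  "sgn_int x = (if x > 0 then 1 else if x < 0 then -1 else 0)"

fun cross :: "real \<times> real \<Rightarrow> real \<times> real \<Rightarrow> real" where
  "cross (x, y) (x', y') = x * y' - y * x'"

text \<open>Each vector enters two factors, so the value depends only on the lines spanned: it is
  the cyclic orientation of three points of the projective line, and 0 if two of them
  coincide.\<close>

definition orientation :: "real \<times> real \<Rightarrow> real \<times> real \<Rightarrow> real \<times> real \<Rightarrow> int" where
  "orientation u v w = sgn_int (cross u v) * sgn_int (cross v w) * sgn_int (cross w u)"

section \<open>Signs of cross products\<close>

lemma sgn_int_uminus: "sgn_int (- x) = - sgn_int x"
  by (simp add: sgn_int_def)

lemma sgn_int_mult: "sgn_int (x * y) = sgn_int x * sgn_int y"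
  by (auto simp: sgn_int_def mult_less_0_iff zero_less_mult_iff)

lemma sgn_int_cases: "sgn_int x \<in> {-1, 0, 1}"
  by (simp add: sgn_int_def)

lemma sgn_int_eq_0: "sgn_int x = 0 \<longleftrightarrow> x = 0"
  by (simp add: sgn_int_def)

lemma cross_swap: "cross v u = - cross u v"
  by (cases u; cases v) simp

text \<open>Both coordinates of \<open>v\<close>, multiplied by \<open>cross u w\<close>, give 0,
  and one of them is nonzero.\<close>

lemma cross_eq_0_trans:
  assumes "v \<noteq> (0, 0)" "cross u v = 0" "cross v w = 0"
  shows "cross u w = 0"
proof -
  obtain x y p q z r where e: "u = (x, y)" "v = (p, q)" "w = (z, r)" by (metis surj_pair)
  have "p * cross u w = z * cross u v + x * cross v w" "q * cross u w = r * cross u v + y * cross v w"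
    by (simp_all add: e algebra_simps)
  then show ?thesis using assms by (auto simp: e)
qed

lemma pluecker: "cross u v * cross w x = cross u w * cross v x + cross x u * cross v w"
  by (cases u; cases v; cases w; cases x) (simp add: algebra_simps)

lemma sgn_int_add:
  "sgn_int y = sgn_int z \<Longrightarrow> sgn_int (y + z) = sgn_int y"
  "sgn_int y = 0 \<Longrightarrow> sgn_int (y + z) = sgn_int z"
  "sgn_int z = 0 \<Longrightarrow> sgn_int (y + z) = sgn_int y"
  by (auto simp: sgn_int_def split: if_splits)

text \<open>The cocycle identity as a finite check, with \<open>A, ..., F\<close> the signs of the
  six cross products of four vectors. The first three premises are what the Pluecker relation says
  about signs, the others say that a vector is parallel to both or neither of two parallel
  ones.\<close>

lemma orientation_signs:
  "\<forall>A\<in>{-1, 0, 1 :: int}. \<forall>B\<in>{-1, 0, 1}. \<forall>C\<in>{-1, 0, 1}. \<forall>D\<in>{-1, 0, 1}. \<forall>E\<in>{-1, 0, 1}. \<forall>F\<in>{-1, 0, 1}.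
    (E * F = D * B \<longrightarrow> A * C = E * F) \<longrightarrow> (E * F = 0 \<longrightarrow> A * C = D * B) \<longrightarrow> (D * B = 0 \<longrightarrow> A * C = E * F) \<longrightarrow>
    (A = 0 \<longrightarrow> (B = 0 \<longleftrightarrow> E = 0)) \<longrightarrow> (A = 0 \<longrightarrow> (F = 0 \<longleftrightarrow> D = 0)) \<longrightarrow> (E = 0 \<longrightarrow> (C = 0 \<longleftrightarrow> D = 0)) \<longrightarrow>
    (B = 0 \<longrightarrow> (C = 0 \<longleftrightarrow> F = 0)) \<longrightarrow> (C = 0 \<longrightarrow> (F = 0 \<longleftrightarrow> B = 0)) \<longrightarrow>
    D * (A * F - E * C) + B * (A * E - C * F) = 0"
  by simp

lemma orientation_cocycle:
  assumes "u \<noteq> (0, 0)" "v \<noteq> (0, 0)" "w \<noteq> (0, 0)" "x \<noteq> (0, 0)"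
  shows "orientation v w x - orientation u w x + orientation u v x - orientation u v w = 0"
proof -
  let ?A = "cross u v" and ?B = "cross v w" and ?C = "cross w x" and ?D = "cross x u"
    and ?E = "cross u w" and ?F = "cross v x"
  let ?s = sgn_int
  have zero: "p \<noteq> (0, 0) \<Longrightarrow> q \<noteq> (0, 0) \<Longrightarrow> cross p q = 0 \<Longrightarrow> cross q r = 0 \<longleftrightarrow> cross p r = 0" for p q r
    using cross_eq_0_trans[of q p r] cross_eq_0_trans[of p q r] cross_swap[of p q] by auto
  have "?s ?D * (?s ?A * ?s ?F - ?s ?E * ?s ?C) + ?s ?B * (?s ?A * ?s ?E - ?s ?C * ?s ?F) = 0"
  proof (intro orientation_signs[rule_format] impI)
    have s: "?s ?A * ?s ?C = ?s (?E * ?F + ?D * ?B)"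
      by (simp only: pluecker[of u v w x, symmetric] sgn_int_mult)
    show "?s ?A * ?s ?C = ?s ?E * ?s ?F" if "?s ?E * ?s ?F = ?s ?D * ?s ?B"
      using that unfolding s by (simp only: sgn_int_mult[symmetric] sgn_int_add)
    show "?s ?A * ?s ?C = ?s ?D * ?s ?B" if "?s ?E * ?s ?F = 0"
      using that unfolding s by (simp only: sgn_int_mult[symmetric] sgn_int_add)
    show "?s ?A * ?s ?C = ?s ?E * ?s ?F" if "?s ?D * ?s ?B = 0"
      using that unfolding s by (simp only: sgn_int_mult[symmetric] sgn_int_add)
    show "?s ?B = 0 \<longleftrightarrow> ?s ?E = 0" if "?s ?A = 0"
      using that zero[of u v w] assms by (simp add: sgn_int_eq_0)
    show "?s ?F = 0 \<longleftrightarrow> ?s ?D = 0" if "?s ?A = 0"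
      using that zero[of u v x] cross_swap[of x u] assms by (simp add: sgn_int_eq_0)
    show "?s ?C = 0 \<longleftrightarrow> ?s ?D = 0" if "?s ?E = 0"
      using that zero[of u w x] cross_swap[of x u] assms by (simp add: sgn_int_eq_0)
    show "?s ?C = 0 \<longleftrightarrow> ?s ?F = 0" if "?s ?B = 0"
      using that zero[of v w x] assms by (simp add: sgn_int_eq_0)
    show "?s ?F = 0 \<longleftrightarrow> ?s ?B = 0" if "?s ?C = 0"
      using that zero[of w x v] cross_swap[of v w] cross_swap[of v x] assms by (simp add: sgn_int_eq_0)
  qed (rule sgn_int_cases)+
  then show ?thesis
    unfolding orientation_def cross_swap[of u x, symmetric] cross_swap[of w u] cross_swap[of x v]
    by (simp add: sgn_int_uminus cross_swap[of v x] cross_swap[of u w] algebra_simps)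
qed

section \<open>The special linear group and its action on the plane\<close>

fun sl2_mult :: "real \<times> real \<times> real \<times> real \<Rightarrow> real \<times> real \<times> real \<times> real \<Rightarrow> real \<times> real \<times> real \<times> real" where
  "sl2_mult (p, q, r, s) (p', q', r', s') = (p * p' + q * r', p * q' + q * s', r * p' + s * r', r * q' + s * s')"

definition sl2 :: "(real \<times> real \<times> real \<times> real) monoid" where
  "sl2 = \<lparr>carrier = {(p, q, r, s). p * s - q * r = 1}, monoid.mult = sl2_mult, one = (1, 0, 0, 1)\<rparr>"

fun sl2_inv :: "real \<times> real \<times> real \<times> real \<Rightarrow> real \<times> real \<times> real \<times> real" where
  "sl2_inv (p, q, r, s) = (s, - q, - r, p)"

fun sl2_app :: "real \<times> real \<times> real \<times> real \<Rightarrow> real \<times> real \<Rightarrow> real \<times> real" where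
  "sl2_app (p, q, r, s) (x, y) = (p * x + q * y, r * x + s * y)"

lemma group_sl2: "group sl2"
proof (rule groupI)
  show "x \<otimes>\<^bsub>sl2\<^esub> y \<in> carrier sl2" if "x \<in> carrier sl2" "y \<in> carrier sl2" for x y
  proof -
    obtain p q r s p' q' r' s' where e: "x = (p, q, r, s)" "y = (p', q', r', s')" by (metis surj_pair)
    have "(p * p' + q * r') * (r * q' + s * s') - (p * q' + q * s') * (r * p' + s * r')
        = (p * s - q * r) * (p' * s' - q' * r')" by algebra
    also have "\<dots> = 1" using that by (simp add: sl2_def e)
    finally show ?thesis by (simp add: sl2_def e)
  qed
  show "\<exists>y\<in>carrier sl2. y \<otimes>\<^bsub>sl2\<^esub> x = \<one>\<^bsub>sl2\<^esub>" if "x \<in> carrier sl2" for x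
    using that by (intro bexI[of _ "sl2_inv x"]) (auto simp: sl2_def algebra_simps)
qed (auto simp: sl2_def algebra_simps)

lemma inv_sl2: "x \<in> carrier sl2 \<Longrightarrow> inv\<^bsub>sl2\<^esub> x = sl2_inv x"
  by (rule group.inv_equality[OF group_sl2]) (auto simp: sl2_def algebra_simps)

lemma sl2_app_mult: "sl2_app (x \<otimes>\<^bsub>sl2\<^esub> y) v = sl2_app x (sl2_app y v)"
  by (cases x; cases y; cases v) (auto simp: sl2_def algebra_simps)

lemma cross_sl2_app:
  assumes "x \<in> carrier sl2"
  shows "cross (sl2_app x u) (sl2_app x v) = cross u v"
proof -
  obtain p q r s a b c d where e: "x = (p, q, r, s)" "u = (a, b)" "v = (c, d)" by (metis surj_pair)
  have "cross (sl2_app x u) (sl2_app x v) = (p * s - q * r) * cross u v"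
    by (simp add: e algebra_simps)
  then show ?thesis using assms by (simp add: sl2_def e)
qed

lemma sl2_app_nonzero:
  assumes "x \<in> carrier sl2"
  shows "sl2_app x (1, 0) \<noteq> (0, 0)"
  using assms by (cases x) (auto simp: sl2_def)

text \<open>The inhomogeneous form of the orientation of three points in the orbit of the line
  through \<open>(1, 0)\<close>.\<close>

definition sl2_cocycle :: "real \<times> real \<times> real \<times> real \<Rightarrow> real \<times> real \<times> real \<times> real \<Rightarrow> int" where
  "sl2_cocycle x y = orientation (1, 0) (sl2_app x (1, 0)) (sl2_app x (sl2_app y (1, 0)))"

lemma sl2_cocycle:
  assumes x: "x \<in> carrier sl2" and y: "y \<in> carrier sl2" and z: "z \<in> carrier sl2"
  shows "sl2_cocycle y z - sl2_cocycle (x \<otimes>\<^bsub>sl2\<^esub> y) z + sl2_cocycle x (y \<otimes>\<^bsub>sl2\<^esub> z) - sl2_cocycle x y = 0"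
proof -
  interpret group sl2 by (rule group_sl2)
  let ?e = "(1, 0)"
  \<comment> \<open>Determinant 1 preserves cross products, so all three points can be moved by
    \<open>x\<close>. What remains is the cocycle identity for four points of the orbit.\<close>
  have "sl2_cocycle y z = orientation (sl2_app x ?e) (sl2_app x (sl2_app y ?e)) (sl2_app x (sl2_app y (sl2_app z ?e)))"
    by (simp only: sl2_cocycle_def orientation_def cross_sl2_app[OF x])
  moreover have "sl2_app x (sl2_app y ?e) \<noteq> (0, 0)" "sl2_app x (sl2_app y (sl2_app z ?e)) \<noteq> (0, 0)"
    using sl2_app_nonzero x y z by (simp_all add: sl2_app_mult[symmetric])
  ultimately show ?thesis
    using orientation_cocycle[of ?e "sl2_app x ?e"] sl2_app_nonzero[OF x]
    by (simp add: sl2_cocycle_def sl2_app_mult)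
qed

lemma abs_orientation: "\<bar>orientation u v w\<bar> \<le> 1"
  by (simp add: orientation_def sgn_int_def)

section \<open>The group\<close>

text \<open>The generators 0, 1, 2 are \<open>a, b, c\<close>, and the generators from 3 on are central.\<close>

definition orbifold_relators :: "nat \<Rightarrow> (nat \<times> bool) list set" where
  "orbifold_relators m =
    {[(2, True), (1, True), (0, True), (1, False), (0, False)], [(2, True), (2, True), (2, True), (2, True)]} \<union>
    (\<lambda>(s, t). [(s, True), (t, True), (s, False), (t, False)]) ` ({..<m + 3} \<times> {3..<m + 3})"

text \<open>With \<open>a = diag(2, 1/2)\<close> and \<open>det b = 1\<close>, the trace of the commutator \<open>[a, b]\<close> is \<open>2 - (9/4) b\<^sub>1\<^sub>2 b\<^sub>2\<^sub>1\<close>. The entries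
  of \<open>b\<close> make it vanish, so that \<open>c = [a, b]\<close> has order 4.\<close>

definition orbifold_matrix :: "nat \<Rightarrow> real \<times> real \<times> real \<times> real" where
  "orbifold_matrix s = (if s = 0 then (2, 0, 0, 1/2) else if s = 1 then (1, 8/9, 1, 17/9)
     else if s = 2 then (-5/3, 8/3, -17/12, 5/3) else (1, 0, 0, 1))"

lemma orbifold_matrix_mem: "orbifold_matrix s \<in> carrier sl2"
  by (simp add: orbifold_matrix_def sl2_def)

lemma eval_orbifold_relators_sl2:
  assumes "r \<in> orbifold_relators m"
  shows "eval_word sl2 orbifold_matrix r = \<one>\<^bsub>sl2\<^esub>"
proof -
  consider "r = [(2, True), (1, True), (0, True), (1, False), (0, False)]"
    | "r = [(2, True), (2, True), (2, True), (2, True)]"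
    | s t where "r = [(s, True), (t, True), (s, False), (t, False)]" "t \<ge> 3"
    using assms by (auto simp: orbifold_relators_def)
  then show ?thesis
  proof cases
    case (3 s t)
    interpret group sl2 by (rule group_sl2)
    have "orbifold_matrix t = \<one>\<^bsub>sl2\<^esub>" using 3(2) by (simp add: orbifold_matrix_def sl2_def)
    then show ?thesis using orbifold_matrix_mem[of s] by (simp add: 3(1))
  qed (simp_all add: inv_sl2[OF orbifold_matrix_mem], simp_all add: orbifold_matrix_def sl2_def)
qed

text \<open>The exponent sum of the generator \<open>j + 3\<close> is 0 in each commutator, and the
  other two relators do not contain this generator.\<close>

lemma eval_orbifold_relators_integer:
  assumes "r \<in> orbifold_relators m"
  shows "eval_word integer_group (\<lambda>s. if s = j + 3 then 1 else 0) r = \<one>\<^bsub>integer_group\<^esub>"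
  using assms by (auto simp: orbifold_relators_def)

context group
begin

section \<open>From relators to relations\<close>

lemma eq_of_mult_inv_eq_one:
  assumes "x \<in> carrier G" "y \<in> carrier G" "x \<otimes> inv y = \<one>"
  shows "x = y"
  using inv_equality[OF assms(3)] assms by simp

lemma relator_commutes:
  assumes "x \<in> carrier G" "y \<in> carrier G" "x \<otimes> (y \<otimes> (inv x \<otimes> inv y)) = \<one>"
  shows "x \<otimes> y = y \<otimes> x"
  by (rule eq_of_mult_inv_eq_one) (use assms in \<open>simp_all add: inv_mult_group m_assoc\<close>)

lemma relator_twisted_commutes:
  assumes "x \<in> carrier G" "y \<in> carrier G" "z \<in> carrier G" "z \<otimes> (y \<otimes> (x \<otimes> (inv y \<otimes> inv x))) = \<one>"
  shows "z \<otimes> y \<otimes> x = x \<otimes> y"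
  by (rule eq_of_mult_inv_eq_one) (use assms in \<open>simp_all add: inv_mult_group m_assoc\<close>)

end

text \<open>Two of the three points coincide. Elements acting trivially therefore satisfy the
  conditions on \<open>B\<close> that are imposed on the central elements.\<close>

lemma sl2_cocycle_one:
  "sl2_cocycle \<one>\<^bsub>sl2\<^esub> y = 0" "sl2_cocycle x \<one>\<^bsub>sl2\<^esub> = 0"
  by (cases x; cases y; simp add: sl2_cocycle_def orientation_def sl2_def sgn_int_def)+

lemma ex_detected_cocycle:
  obtains G :: "nat monoid" and B t a b c where "finitely_presented G" "detected_cocycle G B t m a b c"
proof -
  define S where "S = {..<m + 3}"
  define R where "R = orbifold_relators m"
  have R: "R \<subseteq> words S" by (auto simp: R_def S_def orbifold_relators_def words_def)
  have fin: "finite S" "finite R" by (simp_all add: S_def R_def orbifold_relators_def)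
  define P where "P = presented_group S R"
  interpret P: group P unfolding P_def by (rule group_presented_group[OF R])
  define X where "X s = word_class S R [(s, True)]" for s
  have X_word: "[(s, True)] \<in> words S" if "s \<in> S" for s using that by (simp add: words_def)
  have X: "X s \<in> carrier P" if "s \<in> S" for s
    using X_word[OF that] by (simp add: P_def X_def carrier_presented_group[OF R])
  have small: "0 \<in> S" "1 \<in> S" "2 \<in> S" by (simp_all add: S_def)
  have rel: "eval_word P X r = \<one>\<^bsub>P\<^esub>" if "r \<in> R" for r
    using eval_word_word_class[OF R subsetD[OF R that]] word_class_relator[OF R that]
    by (simp add: P_def X_def[abs_def])
  have "[(2, True), (1, True), (0, True), (1, False), (0, False)] \<in> R" "[(2, True), (2, True), (2, True), (2, True)] \<in> R"
    unfolding R_def orbifold_relators_def by blast+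
  from this[THEN rel] have rel_abc: "X 2 \<otimes>\<^bsub>P\<^esub> X 1 \<otimes>\<^bsub>P\<^esub> X 0 = X 0 \<otimes>\<^bsub>P\<^esub> X 1"
    and rel_c: "X 2 \<otimes>\<^bsub>P\<^esub> (X 2 \<otimes>\<^bsub>P\<^esub> (X 2 \<otimes>\<^bsub>P\<^esub> X 2)) = \<one>\<^bsub>P\<^esub>"
    using X[OF small(1)] X[OF small(2)] X[OF small(3)] by (simp_all add: P.relator_twisted_commutes)
  have X_central: "X (j + 3) \<otimes>\<^bsub>P\<^esub> g = g \<otimes>\<^bsub>P\<^esub> X (j + 3)" if j: "j < m" and g: "g \<in> carrier P" for j g
    unfolding P_def
  proof (rule presented_group_central[OF R])
    have "j + 3 \<in> S" using j by (simp add: S_def)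
    then show "X (j + 3) \<in> carrier (presented_group S R)" using X by (simp add: P_def)
    show "X (j + 3) \<otimes>\<^bsub>presented_group S R\<^esub> word_class S R [(s, True)]
        = word_class S R [(s, True)] \<otimes>\<^bsub>presented_group S R\<^esub> X (j + 3)" if "s \<in> S" for s
    proof -
      have "[(s, True), (j + 3, True), (s, False), (j + 3, False)] \<in> R"
        using that j by (auto simp: R_def S_def orbifold_relators_def)
      from rel[OF this] P.relator_commutes[OF X[OF that] X[OF \<open>j + 3 \<in> S\<close>]]
      have "X s \<otimes>\<^bsub>P\<^esub> X (j + 3) = X (j + 3) \<otimes>\<^bsub>P\<^esub> X s"
        using X[OF \<open>j + 3 \<in> S\<close>] by simp
      then show ?thesis by (simp add: P_def X_def)
    qed
    show "g \<in> carrier (presented_group S R)" using g by (simp add: P_def)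
  qed
  obtain \<sigma> where \<sigma>: "\<sigma> \<in> hom P sl2" and \<sigma>w: "\<And>w. w \<in> words S \<Longrightarrow> \<sigma> (word_class S R w) = eval_word sl2 orbifold_matrix w"
    using presented_group_hom[OF R group_sl2 orbifold_matrix_mem eval_orbifold_relators_sl2[of _ m]]
    unfolding P_def R_def by blast
  have \<sigma>X: "\<sigma> (X s) = orbifold_matrix s" if "s \<in> S" for s
  proof -
    interpret Q: group sl2 by (rule group_sl2)
    show ?thesis using \<sigma>w[OF X_word[OF that]] orbifold_matrix_mem[of s] by (simp add: X_def)
  qed
  \<comment> \<open>\<open>\<tau> j\<close> is the exponent sum of the generator
    \<open>j + 3\<close>.\<close>
  have "\<exists>\<tau>. \<tau> \<in> hom P integer_group \<and> (\<forall>s\<in>S. \<tau> (X s) = (if s = j + 3 then 1 else 0))" for j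
  proof -
    obtain \<tau> where "\<tau> \<in> hom P integer_group"
      "\<And>w. w \<in> words S \<Longrightarrow> \<tau> (word_class S R w) = eval_word integer_group (\<lambda>s. if s = j + 3 then 1 else 0) w"
      using presented_group_hom[OF R group_integer_group _ eval_orbifold_relators_integer[of _ m j]]
      unfolding P_def R_def carrier_integer_group by blast
    then show ?thesis using X_word by (auto simp: X_def intro!: exI[of _ \<tau>])
  qed
  then obtain \<tau> where \<tau>: "\<And>j. \<tau> j \<in> hom P integer_group"
    and \<tau>X: "\<And>j s. s \<in> S \<Longrightarrow> \<tau> j (X s) = (if s = j + 3 then 1 else 0)" by metis
  obtain G :: "nat monoid" and \<phi> where G: "finitely_presented G" and "\<phi> \<in> iso P G"
    using finitely_presented_nat_copy[OF fin R] unfolding P_def by blast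
  then have "group G" by (simp add: finitely_presented_def)
  then interpret G: group G .
  have \<phi>c: "\<phi> x \<in> carrier G" if "x \<in> carrier P" for x
    using \<open>\<phi> \<in> iso P G\<close> that by (auto simp: iso_def hom_def)
  have \<phi>m: "\<phi> (x \<otimes>\<^bsub>P\<^esub> y) = \<phi> x \<otimes>\<^bsub>G\<^esub> \<phi> y" if "x \<in> carrier P" "y \<in> carrier P" for x y
    using \<open>\<phi> \<in> iso P G\<close> that by (auto simp: iso_def hom_def)
  have \<phi>_one: "\<phi> \<one>\<^bsub>P\<^esub> = \<one>\<^bsub>G\<^esub>"
    using \<open>\<phi> \<in> iso P G\<close> hom_one[OF _ P.is_group \<open>group G\<close>] by (simp add: iso_def)
  define \<psi> where "\<psi> = inv_into (carrier P) \<phi>"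
  have "\<psi> \<in> iso G P" using P.iso_set_sym[OF \<open>\<phi> \<in> iso P G\<close>] by (simp add: \<psi>_def)
  then have \<psi>c: "\<psi> x \<in> carrier P" and \<psi>m: "y \<in> carrier G \<Longrightarrow> \<psi> (x \<otimes>\<^bsub>G\<^esub> y) = \<psi> x \<otimes>\<^bsub>P\<^esub> \<psi> y"
    if "x \<in> carrier G" for x y
    using that by (auto simp: iso_def hom_def)
  have \<phi>\<psi>: "\<phi> (\<psi> g) = g" if "g \<in> carrier G" for g
    using \<open>\<phi> \<in> iso P G\<close> that by (auto simp: \<psi>_def iso_def bij_betw_def intro!: f_inv_into_f)
  have \<psi>\<phi>: "\<psi> (\<phi> x) = x" if "x \<in> carrier P" for x
    using \<open>\<phi> \<in> iso P G\<close> that by (auto simp: \<psi>_def iso_def bij_betw_def)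
  have \<sigma>c: "\<sigma> x \<in> carrier sl2" and \<sigma>m: "y \<in> carrier P \<Longrightarrow> \<sigma> (x \<otimes>\<^bsub>P\<^esub> y) = \<sigma> x \<otimes>\<^bsub>sl2\<^esub> \<sigma> y"
    if "x \<in> carrier P" for x y
    using \<sigma> that by (auto simp: hom_def)
  have \<tau>m: "\<tau> j (x \<otimes>\<^bsub>P\<^esub> y) = \<tau> j x + \<tau> j y" if "x \<in> carrier P" "y \<in> carrier P" for j x y
    using \<tau>[of j] that by (auto simp: hom_def)
  have \<sigma>_one: "\<sigma> \<one>\<^bsub>P\<^esub> = \<one>\<^bsub>sl2\<^esub>" by (rule hom_one[OF \<sigma> P.is_group group_sl2])
  have \<tau>_one: "\<tau> j \<one>\<^bsub>P\<^esub> = 0" for j using hom_one[OF \<tau> P.is_group group_integer_group] by simp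
  \<comment> \<open>The cocycle and the homomorphisms are pulled back to the copy \<open>G\<close>
    along the inverse \<open>\<psi>\<close> of \<open>\<phi>\<close>.\<close>
  let ?B = "\<lambda>g h. sl2_cocycle (\<sigma> (\<psi> g)) (\<sigma> (\<psi> h))" and ?t = "\<lambda>j g. \<tau> j (\<psi> g)"
  have "detected_cocycle G ?B ?t m (\<phi> (X 0)) (\<phi> (X 1)) (\<phi> (X 2))"
  proof (intro detected_cocycle.intro[OF \<open>group G\<close>] detected_cocycle_axioms.intro)
    show "?B h k - ?B (g \<otimes>\<^bsub>G\<^esub> h) k + ?B g (h \<otimes>\<^bsub>G\<^esub> k) - ?B g h = 0"
      if "g \<in> carrier G" "h \<in> carrier G" "k \<in> carrier G" for g h k
      using that sl2_cocycle[of "\<sigma> (\<psi> g)" "\<sigma> (\<psi> h)" "\<sigma> (\<psi> k)"] by (simp add: \<psi>c \<psi>m \<sigma>c \<sigma>m)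
    show "\<bar>?B g h\<bar> \<le> 1" for g h by (simp add: sl2_cocycle_def abs_orientation)
    show "?t j (g \<otimes>\<^bsub>G\<^esub> h) = ?t j g + ?t j h" if "g \<in> carrier G" "h \<in> carrier G" for j g h
      using that by (simp add: \<psi>c \<psi>m \<tau>m)
    show "\<exists>s\<in>carrier G. (\<forall>g\<in>carrier G. s \<otimes>\<^bsub>G\<^esub> g = g \<otimes>\<^bsub>G\<^esub> s \<and> ?B s g = 0 \<and> ?B g s = 0) \<and>
      (\<forall>i<m. ?t i s = (if i = j then int k else 0))" if j: "j < m" for j k
    proof -
      let ?x = "X (j + 3)"
      \<comment> \<open>The power of a central generator: its matrix is the identity, and only
        \<open>\<tau> j\<close> sees it, with value \<open>k\<close>.\<close>
      define s where "s = ?x [^]\<^bsub>P\<^esub> k"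
      have jS: "j + 3 \<in> S" using j by (simp add: S_def)
      note x = X[OF jS]
      have s: "s \<in> carrier P" using x by (simp add: s_def)
      have "\<sigma> ?x = \<one>\<^bsub>sl2\<^esub>" using \<sigma>X[OF jS] by (simp add: orbifold_matrix_def sl2_def)
      then have "\<sigma> s = \<one>\<^bsub>sl2\<^esub>"
        unfolding s_def using x group.is_monoid[OF group_sl2]
        by (induction k) (simp_all add: \<sigma>_one \<sigma>m monoid.l_one)
      moreover have "\<tau> i s = (if i = j then int k else 0)" for i
        unfolding s_def using x \<tau>X[OF jS, of i] by (induction k) (auto simp: \<tau>_one \<tau>m)
      moreover have "\<phi> s \<otimes>\<^bsub>G\<^esub> g = g \<otimes>\<^bsub>G\<^esub> \<phi> s" if g: "g \<in> carrier G" for g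
      proof -
        have "s \<otimes>\<^bsub>P\<^esub> \<psi> g = \<psi> g \<otimes>\<^bsub>P\<^esub> s"
          unfolding s_def using P.group_commutes_pow[OF X_central[OF j] x] \<psi>c[OF g] by simp
        then have "\<phi> (s \<otimes>\<^bsub>P\<^esub> \<psi> g) = \<phi> (\<psi> g \<otimes>\<^bsub>P\<^esub> s)" by simp
        then show ?thesis using g s \<psi>c[OF g] by (simp add: \<phi>m \<phi>\<psi>)
      qed
      ultimately show ?thesis
        using \<phi>c[OF s] by (intro bexI[of _ "\<phi> s"]) (simp_all add: \<psi>\<phi>[OF s] sl2_cocycle_one)
    qed
  \<comment> \<open>The matrix of \<open>a\<close> fixes the line through \<open>(1, 0)\<close> and
    the square of that of \<open>c\<close> is minus the identity, so two points coincide in every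
    value of \<open>B\<close> except \<open>B c b\<close>. For that one the points are spanned by
    \<open>(1, 0)\<close>, \<open>(-5/3, -17/12)\<close> and \<open>(1, 1/4)\<close>.\<close>
  qed (use X[OF small(1)] X[OF small(2)] X[OF small(3)] in \<open>simp_all add: \<phi>c \<phi>m[symmetric] \<phi>_one[symmetric]
        \<psi>\<phi> \<sigma>m \<sigma>_one \<sigma>X[OF small(1)] \<sigma>X[OF small(2)] \<sigma>X[OF small(3)] rel_abc rel_c sl2_cocycle_one del: One_nat_def,
      simp_all add: sl2_cocycle_def orientation_def sgn_int_def sl2_def orbifold_matrix_def\<close>)
  with G show ?thesis by (rule that)
qed

theorem proposition17:
  fixes n :: nat
  assumes "n \<ge> 3"
  shows "\<exists>G :: nat monoid. finitely_presented G \<and>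
    \<not> exact_at (bounded_cohomology G n :: (nat list \<Rightarrow> real) set monoid) (comparison_map G n)
        (group_cohomology G n :: (nat list \<Rightarrow> real) set monoid) (iota_map G n)
        (linf_cohomology G n :: (nat list \<Rightarrow> nat \<Rightarrow> real) set monoid) \<and>
    \<not> exact_at (bounded_cohomology G n :: (nat list \<Rightarrow> int) set monoid) (comparison_map G n)
        (group_cohomology G n :: (nat list \<Rightarrow> int) set monoid) (iota_map G n)
        (linf_cohomology G n :: (nat list \<Rightarrow> nat \<Rightarrow> int) set monoid)"
proof -
  obtain G :: "nat monoid" and B t a b c where "finitely_presented G" "detected_cocycle G B t (n - 2) a b c"
    by (rule ex_detected_cocycle)
  moreover from this(2) interpret detected_cocycle G B t "n - 2" a b c .
  have "\<exists>k. x < (of_nat k :: int)" for x by (rule exI[of _ "nat (x + 1)"]) simp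
  \<comment> \<open>\<open>n \<ge> 3\<close> provides at least one central direction; the multiples
    \<open>k\<close> arise by contracting it.\<close>
  moreover have n: "2 + (n - 2) = n" "n - 2 \<ge> 1" using assms by simp_all
  \<comment> \<open>\<open>B\<close> and the \<open>t j\<close> have integer values, so the same
    group serves for both rings.\<close>
  ultimately show ?thesis
    using not_exact[where 'r = real, OF n(2) reals_Archimedean2] not_exact[where 'r = int, OF n(2)]
    unfolding n(1) by blast
qed

end
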